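(* Fix $N\ge1$ and fix a local configuration $j$, with $f_j$ edges, of which $\varepsilon_j$ are endmost edges. For each odd $L\ge7$ let $\mathbb{E}(S_j)$ and $\mathrm{Var}(S_j)$ be the mean and variance of $S_j$ for the cycle graph of length $L$, given by $$\mathbb{E}(\mathbf{S}) = \frac{N}{|T|}\,B\mathbf{1},\qquad \mathrm{Cov}(\mathbf{S}) = \frac{N}{|T|}\left(BB^\top - BD^\top(DD^\top)^{-1}DB^\top\right),$$ where $\mathbf{1}\in\mathbb{R}^T$ is the all-ones vector. Then, as $L\to\infty$ through odd integers, $$\lim_{L\to\infty}\mathbb{E}(S_j) = \frac{N\varphi^{-\varepsilon_j-4}}{\sqrt5} \qquad\text{and}\qquad \lim_{L\to\infty}\mathrm{Var}(S_j) = \frac{N\varphi^{-\varepsilon_j-4}}{\sqrt5}\left(1 - \frac{\varepsilon_j + \varphi^{-1}f_j + \frac{11+\sqrt5}{2}}{\varphi^{\varepsilon_j+6}}\right).$$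
   Context: $\varphi = \frac{1+\sqrt5}{2}$. For odd $L\ge 7$, the cycle graph of length $L$ has vertices $v_1,\dots,v_L$ and edges $v_1v_2,\dots,v_{L-1}v_L,v_Lv_1$. $T$ is the set of its partial matchings (subsets of edges, possibly empty, covering each vertex at most once), called tiles; $s(t)$ is the number of edges of $t\in T$. Incidence matrix. $D$ is the $(L+1)\times|T|$ matrix with rows indexed by $v_0,v_1,\dots,v_L$ ($v_0$ an additional vertex) and columns by $T$, with entries $D_{v_0,t} = L-2s(t)$, and for $1\le i\le L$, $D_{v_i,t}=1$ if $t$ covers $v_i$ and $0$ otherwise. For odd $L$ the matrix $DD^\top$ is invertible. Local configurations. A local configuration is a subset of the six edges $\{v_Lv_1, v_1v_2, v_2v_3, v_3v_4, v_4v_5, v_5v_6\}$ covering each of $v_1,\dots,v_5$ at most once. There are 21 of them, and they are identified for different $L$ in the obvious way. Let $J$ be the set of local configurations; each tile $t\in T$ has a local configuration, namely its intersection with these six edges, and $j\in J$ is also identified with the set of tiles having local configuration $j$. $f_j$ is the number of edges in $j$, and $\varepsilon_j\in\{0,1,2\}$ is the number of edges among the endmost edges $v_Lv_1$, $v_5v_6$ contained in $j$. $B$ is the $|J|\times|T|$ matrix with $B_{j,t}=1$ if $t$ has local configuration $j$ and $0$ otherwise. Meaning of $S_j$. $S_j$ counts the number of occurrences of tiles with local configuration $j$ in a random colored multiweb (an assignment of one of the tiles in $T$ to each of $N$ colors, with prescribed vertex multiplicities), with all initial tile weights equal to $1$ and with constant vertex density such that the critical tile weights are uniform. The stated mean vector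 and covariance matrix are those of the multidimensional Gaussian describing $\mathbf{S} = (S_j)_{j\in J}$ for large vertex multiplicities and large $N$; $\mathbb{E}(S_j)$ is the $j$-th entry of $\mathbb{E}(\mathbf{S})$ and $\mathrm{Var}(S_j)$ is the $(j,j)$ diagonal entry of $\mathrm{Cov}(\mathbf{S})$. *)

theory Defs
  imports Complex_Main "HOL-Library.Countable_Set"
    "Jordan_Normal_Form.Gauss_Jordan_Elimination"
begin

definition golden_ratio :: real where
  "golden_ratio = (1 + sqrt 5) / 2"

text \<open>The vertex \<open>v\<^sub>i\<close> of the cycle of length \<open>L\<close> is the number \<open>i \<in> {1..L}\<close>; edges are
  two-element sets of vertices.\<close>

definition cycle_edges :: "nat \<Rightarrow> nat set set" where
  "cycle_edges L = {{i, i + 1} | i. 1 \<le> i \<and> i < L} \<union> {{L, 1}}"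

definition tiles :: "nat \<Rightarrow> nat set set set" where
  "tiles L = {t. t \<subseteq> cycle_edges L \<and> (\<forall>v\<in>{1..L}. card {e \<in> t. v \<in> e} \<le> 1)}"

text \<open>Matrices have natural-number indices, so a finite index set \<open>X\<close> is enumerated by the
  mutually inverse maps \<^const>\<open>to_nat_on\<close>\<open> X\<close> and \<^const>\<open>from_nat_into\<close>\<open> X\<close>, between \<open>X\<close> and
  \<open>{..<card X}\<close>. The row \<open>0\<close> of the incidence matrix is that of the additional vertex.\<close>

definition incidence_mat :: "nat \<Rightarrow> real mat" where
  "incidence_mat L = mat (L + 1) (card (tiles L)) (\<lambda>(i, c).
     let t = from_nat_into (tiles L) c in
       if i = 0 then real L - 2 * real (card t)
       else if i \<in> \<Union>t then 1 else 0)"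

text \<open>A local configuration is described independently of \<open>L\<close>, on the path with vertices
  \<open>0, 1, \<dots>, 6\<close> in which \<open>0\<close> stands for \<open>v\<^sub>L\<close>. The vertices \<open>0\<close> and \<open>6\<close> need no condition,
  as each lies on only one of the six edges.\<close>

definition path_edges :: "nat set set" where
  "path_edges = {{0, 1}, {1, 2}, {2, 3}, {3, 4}, {4, 5}, {5, 6}}"

definition local_configs :: "nat set set set" where
  "local_configs = {j. j \<subseteq> path_edges \<and> (\<forall>v\<in>{1..5}. card {e \<in> j. v \<in> e} \<le> 1)}"

definition num_endmost :: "nat set set \<Rightarrow> nat" where
  "num_endmost j = card (j \<inter> {{0, 1}, {5, 6}})"

definition embed_edges :: "nat \<Rightarrow> nat set set \<Rightarrow> nat set set" where
  "embed_edges L j = (\<lambda>e. (\<lambda>v. if v = 0 then L else v) ` e) ` j"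

definition has_local_config :: "nat \<Rightarrow> nat set set \<Rightarrow> nat set set \<Rightarrow> bool" where
  "has_local_config L t j \<longleftrightarrow> t \<inter> embed_edges L path_edges = embed_edges L j"

definition config_mat :: "nat \<Rightarrow> real mat" where
  "config_mat L = mat (card local_configs) (card (tiles L)) (\<lambda>(r, c).
     if has_local_config L (from_nat_into (tiles L) c) (from_nat_into local_configs r)
     then 1 else 0)"

definition mean_S :: "nat \<Rightarrow> nat \<Rightarrow> real vec" where
  "mean_S N L = (real N / real (card (tiles L))) \<cdot>\<^sub>v
     (config_mat L *\<^sub>v vec (card (tiles L)) (\<lambda>_. 1))"

text \<open>The inverse below exists for odd \<open>L\<close>.\<close>

definition cov_S :: "nat \<Rightarrow> nat \<Rightarrow> real mat" where
  "cov_S N L = (let B = config_mat L; D = incidence_mat L in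
     (real N / real (card (tiles L))) \<cdot>\<^sub>m
       (B * transpose_mat B
        - B * transpose_mat D * the (mat_inverse (D * transpose_mat D)) * D * transpose_mat B))"

definition expectation_S :: "nat \<Rightarrow> nat \<Rightarrow> nat set set \<Rightarrow> real" where
  "expectation_S N L j = mean_S N L $ to_nat_on local_configs j"

definition variance_S :: "nat \<Rightarrow> nat \<Rightarrow> nat set set \<Rightarrow> real" where
  "variance_S N L j = cov_S N L $$ (to_nat_on local_configs j, to_nat_on local_configs j)"

end

theory Submission
  imports Defs "Jordan_Normal_Form.Determinant"
begin

text \<open>
  Numbering the edges of the cycle, tiles are the independent sets of a cycle of length \<open>L\<close>, and all
  counts are Fibonacci numbers. For odd \<open>L\<close> the row space of \<open>D\<close> is spanned by the constant \<open>1\<close> and the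
  edge indicators \<open>e\<^sub>i\<close>, so the variance is \<open>N\<close> times the squared distance, in \<open>L\<^sup>2\<close> of a uniformly random
  tile, of the indicator of \<open>j\<close> from this span. The second moments of the \<open>e\<^sub>i\<close> are, up to a constant,
  the inverse of the cyclic tridiagonal operator \<open>K\<close> with entries \<open>1, 3, 1\<close>. Hence the projection can be written
  down exactly. Away from the six edges of \<open>j\<close>, the function \<open>i \<mapsto> |{t \<in> j. e\<^sub>i \<in> t}|\<close> is mapped by \<open>K\<close> to a
  constant, so only six terms survive besides an error that is exponentially small in \<open>L\<close>.
\<close>

section \<open>Independent sets in path_indep and cycles\<close>

text \<open>On an odd cycle the neighbouring sums of edge indicators can be solved for the single
  indicators, which fails on an even cycle; the row of the additional vertex then contributes the
  constant. The entries 1, 3, 1 come from the two-edge counts: as a function of the distance d these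
  are a constant plus a combination of (-\<phi>^2)^d and (-\<phi>^2)^(-d), and both geometric modes
  are annihilated because \<phi>^2 + \<phi>^(-2) = 3. What remains is the constant mode and a point
  mass at d = 0. The obstacle is the constant mode: it couples all L edges, and in the variance it
  multiplies a sum that is controlled only to order L. Its coefficient is a difference of two
  products of size \<phi>^(2L), divided by a square of the same size. Agreement of the leading terms
  would only show that this coefficient tends to 0, which is too weak against a factor L. Hence the
  difference is evaluated exactly, by an identity of Cassini type, and turns out to be
  bounded.\<close>

text \<open>\<open>fibp n\<close> is the Fibonacci number \<open>F\<^bsub>n - 1\<^esub>\<close>, with \<open>F\<^bsub>-1\<^esub> = 1\<close>: this shift turns the entries of the
  powers of the transfer matrix into \<open>fibp (n + 2 - a - b)\<close> without case distinction.\<close>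

fun fibp :: "nat \<Rightarrow> nat" where
  "fibp 0 = 1" | "fibp (Suc 0) = 0" | "fibp (Suc (Suc n)) = fibp (Suc n) + fibp n"

section \<open>Independent sets of a path with prescribed states at both ends\<close>

definition path_indep :: "nat \<Rightarrow> nat \<Rightarrow> bool \<Rightarrow> bool \<Rightarrow> nat set set" where
  "path_indep m n a b = {S. S \<subseteq> {m..n} \<and> (\<forall>i\<in>{m..<n}. \<not> (i \<in> S \<and> Suc i \<in> S))
     \<and> (m \<in> S \<longleftrightarrow> a) \<and> (n \<in> S \<longleftrightarrow> b)}"

lemma finite_path_indep [simp]: "finite (path_indep m n a b)"
  by (rule finite_subset[of _ "Pow {m..n}"]) (auto simp: path_indep_def)

lemma path_indep_Suc_False:
  assumes "m \<le> n"
  shows "path_indep m (Suc n) a False = path_indep m n a False \<union> path_indep m n a True"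
  using assms unfolding path_indep_def by (auto simp: atLeastAtMostSuc_conv atLeastLessThanSuc)

lemma path_indep_Suc_True:
  assumes "m \<le> n"
  shows "path_indep m (Suc n) a True = insert (Suc n) ` path_indep m n a False"
proof (intro equalityI subsetI)
  fix S assume S: "S \<in> path_indep m (Suc n) a True"
  then have "S = insert (Suc n) (S - {Suc n})" "S - {Suc n} \<in> path_indep m n a False"
    using assms by (auto simp: path_indep_def atLeastAtMostSuc_conv atLeastLessThanSuc)
  then show "S \<in> insert (Suc n) ` path_indep m n a False" by blast
next
  fix S assume "S \<in> insert (Suc n) ` path_indep m n a False"
  then obtain U where "S = insert (Suc n) U" "U \<in> path_indep m n a False" by blast
  then show "S \<in> path_indep m (Suc n) a True"
    using assms by (auto simp: path_indep_def atLeastAtMostSuc_conv atLeastLessThanSuc)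
qed

lemma card_path_indep: "card (path_indep m (m + n) a b) = fibp (n + 2 - of_bool a - of_bool b)"
proof (induction n arbitrary: b)
  case 0
  \<comment> \<open>Both ends are the same vertex, so the count is 1 if a = b and 0 otherwise. This
    is where the values \<open>fibp 2 = fibp 0 = 1\<close> and \<open>fibp 1 = 0\<close> are
    needed.\<close>
  have "path_indep m m a b = (if a = b then {if a then {m} else {}} else {})"
    by (auto simp: path_indep_def)
  then show ?case by (auto simp: numeral_2_eq_2)
next
  case (Suc n)
  show ?case
  proof (cases b)
    case True
    have "inj_on (insert (Suc (m + n))) (path_indep m (m + n) a False)"
      proof (rule inj_onI)
      fix S U assume "S \<in> path_indep m (m + n) a False" "U \<in> path_indep m (m + n) a False"
      then have "Suc (m + n) \<notin> S" "Suc (m + n) \<notin> U" by (auto simp: path_indep_def)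
      then show "insert (Suc (m + n)) S = insert (Suc (m + n)) U \<Longrightarrow> S = U"
        using insert_ident by metis
    qed
    then have "card (path_indep m (m + Suc n) a b) = card (path_indep m (m + n) a False)"
      using True path_indep_Suc_True[of m "m + n" a] by (simp add: card_image)
    then show ?thesis using Suc True by auto
  next
    case False
    have "path_indep m (m + n) a False \<inter> path_indep m (m + n) a True = {}"
      by (auto simp: path_indep_def)
    then have "card (path_indep m (m + Suc n) a b)
        = card (path_indep m (m + n) a False) + card (path_indep m (m + n) a True)"
      using False path_indep_Suc_False[of m "m + n" a] by (simp add: card_Un_disjoint)
    then show ?thesis using Suc False by (auto simp: numeral_2_eq_2)
  qed
qed

lemma card_path_indep_between:
  assumes "m \<le> n"
  shows "card (path_indep m n a b) = fibp (n - m + 2 - of_bool a - of_bool b)"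
  using card_path_indep[of m "n - m" a b] assms by simp

text \<open>Both halves contain the cut vertex k; once its state is fixed, they can be chosen
  independently. \<open>P\<close> and \<open>R\<close> carry conditions on one half, so that the
  lemma can be iterated over several marked vertices.\<close>

lemma card_path_indep_glue:
  assumes "m \<le> k" "k \<le> n"
  shows "card {S \<in> path_indep m n a b. (k \<in> S \<longleftrightarrow> c) \<and> P (S \<inter> {m..k}) \<and> R (S \<inter> {k..n})}
    = card {U \<in> path_indep m k a c. P U} * card {V \<in> path_indep k n c b. R V}"
proof -
  have U: "(U \<union> V) \<inter> {m..k} = U" "(U \<union> V) \<inter> {k..n} = V" "U \<union> V \<in> path_indep m n a b"
    "k \<in> U \<longleftrightarrow> c" "k \<in> V \<longleftrightarrow> c"
    if "U \<in> path_indep m k a c" "V \<in> path_indep k n c b" for U V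
  proof -
    have *: "U \<subseteq> {m..k}" "V \<subseteq> {k..n}" "k \<in> U \<longleftrightarrow> c" "k \<in> V \<longleftrightarrow> c" "m \<in> U \<longleftrightarrow> a" "n \<in> V \<longleftrightarrow> b"
      "\<And>i. m \<le> i \<Longrightarrow> i < k \<Longrightarrow> \<not> (i \<in> U \<and> Suc i \<in> U)"
      "\<And>i. k \<le> i \<Longrightarrow> i < n \<Longrightarrow> \<not> (i \<in> V \<and> Suc i \<in> V)"
      using that by (auto simp: path_indep_def)
    have mem: "x \<in> (U \<union> V) \<inter> {m..k} \<longleftrightarrow> x \<in> U" "x \<in> (U \<union> V) \<inter> {k..n} \<longleftrightarrow> x \<in> V" for x
      using subsetD[OF *(1), of x] subsetD[OF *(2), of x] *(3,4) by (cases "x = k"; force)+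
    then show 1: "(U \<union> V) \<inter> {m..k} = U" "(U \<union> V) \<inter> {k..n} = V" by blast+
    show "k \<in> U \<longleftrightarrow> c" "k \<in> V \<longleftrightarrow> c" using * by blast+
    have V: "i \<in> U \<union> V \<longleftrightarrow> i \<in> V" if "k \<le> i" "i \<le> n" for i
      using mem(2)[of i] that by simp
    have U: "i \<in> U \<union> V \<longleftrightarrow> i \<in> U" if "m \<le> i" "i \<le> k" for i
      using mem(1)[of i] that by simp
    have "\<not> (i \<in> U \<union> V \<and> Suc i \<in> U \<union> V)" if "m \<le> i" "i < n" for i
      using that * V[of i] V[of "Suc i"] U[of i] U[of "Suc i"] by (cases "i < k") auto
    moreover have "U \<union> V \<subseteq> {m..n}" using *(1,2) assms by fastforce
    moreover have "m \<in> U \<union> V \<longleftrightarrow> a" "n \<in> U \<union> V \<longleftrightarrow> b"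
      using *(5,6) V[of n] U[of m] assms by blast+
    ultimately show "U \<union> V \<in> path_indep m n a b"
      unfolding path_indep_def by (simp del: Un_iff)
  qed
  have S: "S \<inter> {m..k} \<in> path_indep m k a c" "S \<inter> {k..n} \<in> path_indep k n c b"
    "(S \<inter> {m..k}) \<union> (S \<inter> {k..n}) = S"
    if "S \<in> path_indep m n a b" "k \<in> S \<longleftrightarrow> c" for S
  proof -
    have "S \<subseteq> {m..n}" using that by (auto simp: path_indep_def)
    then show "(S \<inter> {m..k}) \<union> (S \<inter> {k..n}) = S" by auto
  qed (use that assms in \<open>auto simp: path_indep_def\<close>)
  have "bij_betw (\<lambda>(U, V). U \<union> V) ({U \<in> path_indep m k a c. P U} \<times> {V \<in> path_indep k n c b. R V})
    {S \<in> path_indep m n a b. (k \<in> S \<longleftrightarrow> c) \<and> P (S \<inter> {m..k}) \<and> R (S \<inter> {k..n})}"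
    by (rule bij_betw_byWitness[where f' = "\<lambda>S. (S \<inter> {m..k}, S \<inter> {k..n})"])
       (use U S in auto)
  from bij_betw_same_card[OF this] show ?thesis
    by (simp add: card_cartesian_product)
qed

text \<open>An entry of the product of two powers of the transfer matrix, that is, the sum over the
  state of a cut vertex. It is used to merge the two pieces of an arc that runs through the vertex
  0.\<close>

lemma fibp_add: "fibp (m + n) = fibp m * fibp n + fibp (Suc m) * fibp (Suc n)"
  by (induction m rule: fibp.induct) (auto simp: algebra_simps)

section \<open>Independent sets of a cycle, with one or two marked sites\<close>

definition cycle_indep :: "nat \<Rightarrow> nat set set" where
  "cycle_indep L = {S. S \<subseteq> {..<L} \<and> (\<forall>i<L. \<not> (i \<in> S \<and> Suc i mod L \<in> S))}"

lemma finite_cycle_indep [simp]: "finite (cycle_indep L)"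
  by (rule finite_subset[of _ "Pow {..<L}"]) (auto simp: cycle_indep_def)

text \<open>The cycle is cut open at 0, and this vertex is counted twice, as 0 and as L. Equal
  states at both ends make the total count a trace of a power of the transfer matrix.\<close>

lemma bij_betw_path_indep_cycle_indep:
  assumes "2 \<le> L"
  shows "bij_betw (\<lambda>S. S \<inter> {..<L}) {S \<in> path_indep 0 L a a. P (S \<inter> {..<L})}
    {S \<in> cycle_indep L. (0 \<in> S \<longleftrightarrow> a) \<and> P S}"
proof (rule bij_betw_byWitness[where f' = "\<lambda>S. S \<union> (if a then {L} else {})"])
  let ?A = "{S \<in> path_indep 0 L a a. P (S \<inter> {..<L})}" and ?B = "{S \<in> cycle_indep L. (0 \<in> S \<longleftrightarrow> a) \<and> P S}"
  have mod: "Suc i mod L = (if Suc i = L then 0 else Suc i)" if "i < L" for i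
    using that by auto
  have *: "(S \<union> (if a then {L} else {})) \<inter> {..<L} = S" if "S \<in> ?B" for S
    using that by (auto simp: cycle_indep_def)
  show "\<forall>S\<in>?B. (S \<union> (if a then {L} else {})) \<inter> {..<L} = S" using * by blast
  have "S \<inter> {..<L} \<union> (if a then {L} else {}) = S" if "S \<in> ?A" for S
  proof -
    have "S \<subseteq> {0..L}" "L \<in> S \<longleftrightarrow> a" using that by (auto simp: path_indep_def)
    then have "x \<in> S \<inter> {..<L} \<union> (if a then {L} else {}) \<longleftrightarrow> x \<in> S" for x
      using subsetD[of S "{0..L}" x] by (cases "x = L") force+
    then show ?thesis by blast
  qed
  then show "\<forall>S\<in>?A. S \<inter> {..<L} \<union> (if a then {L} else {}) = S" by blast
  show "(\<lambda>S. S \<inter> {..<L}) ` ?A \<subseteq> ?B"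
    using assms by (auto simp: path_indep_def cycle_indep_def mod)
  have "S \<union> (if a then {L} else {}) \<in> path_indep 0 L a a" if "S \<in> ?B" for S
  proof -
    have S: "S \<subseteq> {..<L}" "0 \<in> S \<longleftrightarrow> a" "L \<notin> S"
      using \<open>S \<in> ?B\<close> by (auto simp: cycle_indep_def)
    have i: "\<not> (i \<in> S \<and> (if Suc i = L then 0 else Suc i) \<in> S)" if "i < L" for i
      using that \<open>S \<in> ?B\<close> mod[of i] by (auto simp: cycle_indep_def)
    have "\<not> (i \<in> S \<union> (if a then {L} else {}) \<and> Suc i \<in> S \<union> (if a then {L} else {}))" if "i < L" for i
      using S that i[of i] by (cases "Suc i = L") (auto split: if_splits)
    moreover have "S \<union> (if a then {L} else {}) \<subseteq> {0..L}"
      using S(1) by (auto intro: less_imp_le)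
    ultimately show ?thesis
      using assms S(2,3) by (cases a) (simp_all add: path_indep_def)
  qed
  then show "(\<lambda>S. S \<union> (if a then {L} else {})) ` ?B \<subseteq> ?A"
    using * by auto
qed

lemma card_cycle_indep:
  assumes "2 \<le> L"
  shows "card {S \<in> cycle_indep L. P S} = (\<Sum>a\<in>UNIV. card {S \<in> path_indep 0 L a a. P (S \<inter> {..<L})})"
proof -
  have "{S \<in> cycle_indep L. P S} = (\<Union>a\<in>UNIV. {S \<in> cycle_indep L. (0 \<in> S \<longleftrightarrow> a) \<and> P S})" by auto
  also have "card \<dots> = (\<Sum>a\<in>UNIV. card {S \<in> cycle_indep L. (0 \<in> S \<longleftrightarrow> a) \<and> P S})"
    by (rule card_UN_disjoint) (auto)
  also have "\<dots> = (\<Sum>a\<in>UNIV. card {S \<in> path_indep 0 L a a. P (S \<inter> {..<L})})"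
    using bij_betw_same_card[OF bij_betw_path_indep_cycle_indep[OF assms, of _ P]] by simp
  finally show ?thesis .
qed

text \<open>The trace, a Lucas number.\<close>

lemma card_cycle_indep_all:
  assumes "2 \<le> L"
  shows "card (cycle_indep L) = fibp (L + 2) + fibp L"
  using card_cycle_indep[OF assms, of "\<lambda>_. True"] card_path_indep[of 0 L] by (simp add: UNIV_bool)

lemma card_cycle_indep_one:
  assumes "2 \<le> L" "i < L"
  shows "card {S \<in> cycle_indep L. i \<in> S} = fibp L"
proof -
  have "card {S \<in> path_indep 0 L a a. i \<in> S \<inter> {..<L}} = fibp (i + 1 - of_bool a) * fibp (L - i + 1 - of_bool a)" for a
  proof -
    have "card {S \<in> path_indep 0 L a a. i \<in> S \<inter> {..<L}} = card (path_indep 0 i a True) * card (path_indep i L True a)"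
      using card_path_indep_glue[of 0 i L a a True "\<lambda>_. True" "\<lambda>_. True"] assms by simp
    then show ?thesis using assms by (cases a) (simp_all add: card_path_indep_between)
  qed
  then have "card {S \<in> cycle_indep L. i \<in> S} = fibp i * fibp (L - i) + fibp (Suc i) * fibp (Suc (L - i))"
    unfolding card_cycle_indep[OF assms(1)] by (simp add: UNIV_bool)
  then show ?thesis using fibp_add[of i "L - i"] assms by simp
qed

text \<open>One factor for each of the two arcs between the sites. Coinciding sites and neighbouring
  sites fit in, as \<open>fibp 0 = 1\<close> and \<open>fibp 1 = 0\<close>.\<close>

lemma card_cycle_indep_two:
  assumes "2 \<le> L" "i \<le> k" "k < L"
  shows "card {S \<in> cycle_indep L. i \<in> S \<and> k \<in> S} = fibp (k - i) * fibp (L - (k - i))"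
proof -
  have "card {S \<in> path_indep 0 L a a. i \<in> S \<inter> {..<L} \<and> k \<in> S \<inter> {..<L}}
     = fibp (i + 1 - of_bool a) * fibp (k - i) * fibp (L - k + 1 - of_bool a)" for a
  proof -
    have "{S \<in> path_indep 0 L a a. i \<in> S \<inter> {..<L} \<and> k \<in> S \<inter> {..<L}}
      = {S \<in> path_indep 0 L a a. (k \<in> S \<longleftrightarrow> True) \<and> i \<in> S \<inter> {0..k} \<and> True}" using assms by auto
    also have "card \<dots> = card {S \<in> path_indep 0 k a True. i \<in> S} * card (path_indep k L True a)"
      using card_path_indep_glue[of 0 k L a a True "\<lambda>U. i \<in> U" "\<lambda>_. True"] assms by simp
    also have "card {S \<in> path_indep 0 k a True. i \<in> S} = card (path_indep 0 i a True) * card (path_indep i k True True)"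
      using card_path_indep_glue[of 0 i k a True True "\<lambda>_. True" "\<lambda>_. True"] assms by simp
    finally show ?thesis using assms by (cases a) (simp_all add: card_path_indep_between)
  qed
  then have "card {S \<in> cycle_indep L. i \<in> S \<and> k \<in> S}
      = fibp (k - i) * (fibp i * fibp (L - k) + fibp (Suc i) * fibp (Suc (L - k)))"
    unfolding card_cycle_indep[OF assms(1)] by (simp add: UNIV_bool algebra_simps)
  then show ?thesis using fibp_add[of i "L - k"] assms by (simp add: add.commute[of L i])
qed

text \<open>The window contains the vertex 0 and so prescribes the common end state: only one
  summand of the trace survives. It also contains 5, the cut vertex of the next two counts, and the
  arc from 5 to L is all that stays free.\<close>

lemma path_indep_window:
  assumes "6 \<le> L" "W \<in> path_indep 0 5 a b"
  shows "{S \<in> path_indep 0 L c c. S \<inter> {..<L} \<inter> {..5} = W \<and> P S}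
      = (if c = a then {S \<in> path_indep 0 L a a. (5 \<in> S \<longleftrightarrow> b) \<and> S \<inter> {0..5} = W \<and> P S} else {})"
proof -
  have W: "0 \<in> W \<longleftrightarrow> a" "5 \<in> W \<longleftrightarrow> b" using assms by (simp_all add: path_indep_def)
  have S: "S \<inter> {..<L} \<inter> {..5} = S \<inter> {0..5}" for S using assms by auto
  have 1: "0 \<in> S \<longleftrightarrow> a" "5 \<in> S \<longleftrightarrow> b" if "S \<inter> {0..5} = W" for S
    using W that by auto
  have 2: "0 \<in> S \<longleftrightarrow> c" if "S \<in> path_indep 0 L c c" for S
    using that by (simp add: path_indep_def)
  have "S \<in> path_indep 0 L c c \<and> S \<inter> {0..5} = W \<and> P S
      \<longleftrightarrow> c = a \<and> S \<in> path_indep 0 L a a \<and> (5 \<in> S \<longleftrightarrow> b) \<and> S \<inter> {0..5} = W \<and> P S" for S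
    using 1[of S] 2[of S] by (cases "c = a") auto
  then show ?thesis unfolding S by simp
qed

lemma card_cycle_indep_window:
  assumes "6 \<le> L" "W \<in> path_indep 0 5 a b"
  shows "card {S \<in> cycle_indep L. S \<inter> {..5} = W} = fibp (L - 3 - of_bool a - of_bool b)"
proof -
  have L: "L \<ge> 2" using assms by simp
  have "{S \<in> path_indep 0 L c c. S \<inter> {..<L} \<inter> {..5} = W}
      = (if c = a then {S \<in> path_indep 0 L a a. (5 \<in> S \<longleftrightarrow> b) \<and> S \<inter> {0..5} = W \<and> True} else {})" for c
    using path_indep_window[OF assms, of c "\<lambda>_. True"] by simp
  moreover have "{U \<in> path_indep 0 5 a b. U = W} = {W}" using assms(2) by auto
  ultimately have "card {S \<in> path_indep 0 L c c. S \<inter> {..<L} \<inter> {..5} = W}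
      = (if c = a then card (path_indep 5 L b a) else 0)" for c
    using card_path_indep_glue[of 0 5 L a a b "\<lambda>U. U = W" "\<lambda>_. True"] assms(1) by simp
  moreover have "card (path_indep 5 L b a) = fibp (L - 3 - of_bool a - of_bool b)"
  proof -
    have "L - 5 + 2 = L - 3" "5 \<le> L" using assms(1) by simp_all
    then show ?thesis
      using card_path_indep_between[of 5 L b a] by (simp add: diff_commute[of "L - 3" "of_bool b"])
  qed
  ultimately show ?thesis unfolding card_cycle_indep[OF L]
    by (cases a) (simp_all add: UNIV_bool)
qed

lemma card_cycle_indep_window_one:
  assumes "6 \<le> L" "W \<in> path_indep 0 5 a b" "5 \<le> i" "i < L"
  shows "card {S \<in> cycle_indep L. S \<inter> {..5} = W \<and> i \<in> S}
    = fibp (i - 4 - of_bool b) * fibp (L - i + 1 - of_bool a)"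
proof -
  have L: "L \<ge> 2" using assms by simp
  have "{S \<in> path_indep 0 L c c. S \<inter> {..<L} \<inter> {..5} = W \<and> i \<in> S \<inter> {..<L}}
      = (if c = a then {S \<in> path_indep 0 L a a. (5 \<in> S \<longleftrightarrow> b) \<and> S \<inter> {0..5} = W \<and> i \<in> S \<inter> {5..L}} else {})" for c
    using path_indep_window[OF assms(1,2), of c "\<lambda>S. i \<in> S"] assms(3,4) by simp
  moreover have "{U \<in> path_indep 0 5 a b. U = W} = {W}" using assms(2) by auto
  moreover have "card {V \<in> path_indep 5 L b a. i \<in> V} = card (path_indep 5 i b True) * card (path_indep i L True a)"
    using card_path_indep_glue[of 5 i L b a True "\<lambda>_. True" "\<lambda>_. True"] assms by simp
  ultimately have "card {S \<in> path_indep 0 L c c. S \<inter> {..<L} \<inter> {..5} = W \<and> i \<in> S \<inter> {..<L}}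
      = (if c = a then card (path_indep 5 i b True) * card (path_indep i L True a) else 0)" for c
    using card_path_indep_glue[of 0 5 L a a b "\<lambda>U. U = W" "\<lambda>V. i \<in> V"] assms(1) by simp
  moreover have "card (path_indep 5 i b True) = fibp (i - 4 - of_bool b)"
  proof -
    have "i - 5 + 2 - of_bool b - 1 = i - 4 - of_bool b" using assms(3) by simp
    then show ?thesis
      using card_path_indep_between[of 5 i b True] assms(3) by (simp only: diff_commute of_bool_eq(2))
  qed
  ultimately show ?thesis using assms unfolding card_cycle_indep[OF L]
    by (cases a) (simp_all add: UNIV_bool card_path_indep_between)
qed

section \<open>Tiles and their covariance\<close>

text \<open>The matrix expression is the squared length of the orthogonal projection of a row of
  \<open>B\<close> onto the row space of \<open>D\<close>. Any solution \<open>x\<close> of the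
  normal equations yields this projection, so the inverse of the Gram matrix never has to be
  computed.\<close>

lemma quad_form_inverse:
  fixes D B :: "real mat"
  assumes D: "D \<in> carrier_mat m n" and B: "B \<in> carrier_mat k n" and r: "r < k"
    and inj: "\<And>v. v \<in> carrier_vec m \<Longrightarrow> transpose_mat D *\<^sub>v v = 0\<^sub>v n \<Longrightarrow> v = 0\<^sub>v m"
    and x: "x \<in> carrier_vec m"
    and normal: "D *\<^sub>v row B r = D *\<^sub>v (transpose_mat D *\<^sub>v x)"
  shows "(B * transpose_mat D * the (mat_inverse (D * transpose_mat D)) * D * transpose_mat B) $$ (r, r)
    = row B r \<bullet> (transpose_mat D *\<^sub>v x)"
proof -
  let ?A = "D * transpose_mat D"
  have A: "?A \<in> carrier_mat m m" and DT: "transpose_mat D \<in> carrier_mat n m" using D by auto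
  \<comment> \<open>The quadratic form of the Gram matrix at v is the squared norm of the transpose
    applied to v. So injectivity passes to the Gram matrix, and \<open>mat_inverse\<close> does
    return a value.\<close>
  have "v = 0\<^sub>v m" if v: "v \<in> carrier_vec m" "?A *\<^sub>v v = 0\<^sub>v m" for v
  proof -
    let ?u = "transpose_mat D *\<^sub>v v"
    have u: "?u \<in> carrier_vec n" using D v by auto
    have "?u \<bullet> ?u = v \<bullet> (D *\<^sub>v ?u)"
      using transpose_vec_mult_scalar[OF D u v(1)] by simp
    also have "D *\<^sub>v ?u = 0\<^sub>v m" using v(2) assoc_mult_mat_vec[OF D DT v(1)] by simp
    finally have "?u \<bullet> ?u = 0" using v by simp
    then have "?u = 0\<^sub>v n" using u conjugate_square_eq_0_vec[OF u] by simp
    then show ?thesis using inj v by blast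
  qed
  then have "det ?A \<noteq> 0" using det_0_iff_vec_prod_zero_field[OF A] by blast
  then have "?A \<in> Units (ring_mat TYPE(real) m ())" by (rule det_non_zero_imp_unit[OF A])
  then obtain C where C: "mat_inverse ?A = Some C"
    using mat_inverse(1)[OF A, of "()"] by fastforce
  then have CA: "C * ?A = 1\<^sub>m m" and Cc: "C \<in> carrier_mat m m"
    using mat_inverse(2)[OF A C] by auto
  have BT: "transpose_mat B \<in> carrier_mat n k" using B by simp
  have row: "row B r \<in> carrier_vec n" using B r by auto
  have "B * transpose_mat D * C * D * transpose_mat B
      = B * (transpose_mat D * (C * (D * transpose_mat B)))" (is "_ = B * ?X")
    using B D Cc DT BT by (simp add: assoc_mult_mat[of _ k n] assoc_mult_mat[of _ k m]
      assoc_mult_mat[of _ k m _ m] assoc_mult_mat[of _ k m _ n]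
      assoc_mult_mat[of B k n "transpose_mat D * C" m "D * transpose_mat B" k]
      assoc_mult_mat[of "transpose_mat D" n m C m "D * transpose_mat B" k])
  moreover have X: "?X \<in> carrier_mat n k" using B D Cc DT by auto
  moreover have "col ?X r = transpose_mat D *\<^sub>v x"
  proof -
    have "col ?X r = transpose_mat D *\<^sub>v (C *\<^sub>v (D *\<^sub>v row B r))"
      using col_mult2[OF DT _ r, of "C * (D * transpose_mat B)"] col_mult2[OF Cc _ r, of "D * transpose_mat B"]
        col_mult2[OF D BT r] D B Cc r by simp
    also have "D *\<^sub>v row B r = ?A *\<^sub>v x" using normal assoc_mult_mat_vec[OF D DT x] by simp
    also have "C *\<^sub>v (?A *\<^sub>v x) = x" using assoc_mult_mat_vec[OF Cc A x] CA x by simp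
    finally show ?thesis .
  qed
  ultimately show ?thesis using B r C by simp
qed

text \<open>The edges are numbered so that \<open>0, \<dots>, 5\<close> are the six edges of the local configurations;
  edge \<open>0\<close> is \<open>v\<^sub>Lv\<^sub>1\<close>. Tiles then become the independent sets of the cycle on \<open>{0..<L}\<close>.\<close>

definition edge :: "nat \<Rightarrow> nat \<Rightarrow> nat set" where
  "edge L i = {if i = 0 then L else i, Suc i}"

section \<open>Tiles as independent sets of the cycle formed by the edges\<close>

lemma inj_on_edge: "3 \<le> L \<Longrightarrow> inj_on (edge L) {..<L}"
  by (rule inj_onI) (auto simp: edge_def doubleton_eq_iff split: if_splits)

lemma cycle_edges_eq: "1 \<le> L \<Longrightarrow> cycle_edges L = edge L ` {..<L}"
proof (intro equalityI subsetI)
  fix e assume L: "1 \<le> L" and "e \<in> cycle_edges L"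
  then consider i where "1 \<le> i" "i < L" "e = {i, i + 1}" | "e = {L, 1}"
    by (auto simp: cycle_edges_def)
  then show "e \<in> edge L ` {..<L}"
  proof cases
    case 1
    then have "e = edge L i" by (simp add: edge_def)
    then show ?thesis using 1 by blast
  next
    case 2
    then have "e = edge L 0" by (simp add: edge_def)
    then show ?thesis using L by auto
  qed
next
  fix e assume "e \<in> edge L ` {..<L}"
  then obtain i where i: "i < L" "e = edge L i" by auto
  then show "e \<in> cycle_edges L"
    by (cases "i = 0") (auto simp: edge_def cycle_edges_def)
qed

lemma mem_edge_iff:
  "v \<in> {1..L} \<Longrightarrow> i < L \<Longrightarrow> v \<in> edge L i \<longleftrightarrow> i = v - 1 \<or> i = v mod L"
  by (cases "v = L") (auto simp: edge_def)

lemma mem_Union_edges_iff: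
  assumes "v \<in> {1..L}" "S \<subseteq> {..<L}"
  shows "v \<in> \<Union> (edge L ` S) \<longleftrightarrow> v - 1 \<in> S \<or> v mod L \<in> S"
  using assms mem_edge_iff[OF assms(1)] by blast

text \<open>The line graph of a cycle is again a cycle: the edges at vertex v are exactly v - 1 and
  v mod L, and covering v at most once forbids choosing both.\<close>

lemma tiles_edge_image_iff:
  assumes "3 \<le> L" "S \<subseteq> {..<L}"
  shows "edge L ` S \<in> tiles L \<longleftrightarrow> S \<in> cycle_indep L"
proof -
  have "card {e \<in> edge L ` S. v \<in> e} \<le> 1 \<longleftrightarrow> \<not> (v - 1 \<in> S \<and> v mod L \<in> S)" if v: "v \<in> {1..L}" for v
  proof -
    have ne: "v - 1 \<noteq> v mod L" using v assms(1) by (cases "v = L") auto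
    have "{e \<in> edge L ` S. v \<in> e} = edge L ` (S \<inter> {v - 1, v mod L})"
      using mem_edge_iff[OF v] assms(2) by blast
    moreover have "inj_on (edge L) (S \<inter> {v - 1, v mod L})"
      using inj_on_subset[OF inj_on_edge[OF assms(1)]] assms(2) by blast
    ultimately have "card {e \<in> edge L ` S. v \<in> e} = card (S \<inter> {v - 1, v mod L})"
      by (simp add: card_image)
    also have "\<dots> = of_bool (v - 1 \<in> S) + of_bool (v mod L \<in> S)"
      using ne by (cases "v - 1 \<in> S"; cases "v mod L \<in> S") (simp_all add: Int_insert_right)
    finally show ?thesis by auto
  qed
  then have "(\<forall>v\<in>{1..L}. card {e \<in> edge L ` S. v \<in> e} \<le> 1)
     \<longleftrightarrow> (\<forall>v\<in>{1..L}. \<not> (v - 1 \<in> S \<and> v mod L \<in> S))" by blast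
  also have "\<dots> \<longleftrightarrow> (\<forall>i<L. \<not> (i \<in> S \<and> Suc i mod L \<in> S))"
  proof (intro iffI allI impI ballI)
    fix i assume *: "\<forall>v\<in>{1..L}. \<not> (v - 1 \<in> S \<and> v mod L \<in> S)" "i < L"
    then show "\<not> (i \<in> S \<and> Suc i mod L \<in> S)" using bspec[OF *(1), of "Suc i"] by simp
  next
    fix v assume *: "\<forall>i<L. \<not> (i \<in> S \<and> Suc i mod L \<in> S)" "v \<in> {1..L}"
    then show "\<not> (v - 1 \<in> S \<and> v mod L \<in> S)" using spec[OF *(1), of "v - 1"] by auto
  qed
  moreover have "edge L ` S \<subseteq> cycle_edges L" using cycle_edges_eq assms by auto
  ultimately show ?thesis using assms(2) by (simp add: tiles_def cycle_indep_def)
qed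

lemma bij_betw_tiles:
  assumes "3 \<le> L"
  shows "bij_betw ((`) (edge L)) (cycle_indep L) (tiles L)"
  unfolding bij_betw_def
proof
  show "inj_on ((`) (edge L)) (cycle_indep L)"
    using inj_on_image_eq_iff[OF inj_on_edge[OF assms]] by (intro inj_onI) (auto simp: cycle_indep_def)
  show "(`) (edge L) ` cycle_indep L = tiles L"
  proof (intro equalityI subsetI)
    fix t assume "t \<in> (`) (edge L) ` cycle_indep L"
    then obtain S where "t = edge L ` S" "S \<in> cycle_indep L" by blast
    then show "t \<in> tiles L" using tiles_edge_image_iff[OF assms, of S] by (simp add: cycle_indep_def)
  next
    fix t assume t: "t \<in> tiles L"
    then have "t \<subseteq> edge L ` {..<L}" using assms cycle_edges_eq by (simp add: tiles_def)
    then obtain S where "S \<subseteq> {..<L}" "t = edge L ` S" by (auto simp: subset_image_iff)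
    then show "t \<in> (`) (edge L) ` cycle_indep L" using t tiles_edge_image_iff[OF assms] by blast
  qed
qed

section \<open>Local configurations as sets of edge indices up to 5\<close>

definition path_edge :: "nat \<Rightarrow> nat set" where "path_edge i = {i, Suc i}"

lemma inj_path_edge: "inj path_edge"
  by (rule injI) (auto simp: path_edge_def doubleton_eq_iff)

lemma path_edges_eq: "path_edges = path_edge ` {..5}"
proof -
  have "{..5} = {0, 1, 2, 3, 4, 5::nat}" by auto
  then show ?thesis by (simp add: path_edges_def path_edge_def eval_nat_numeral)
qed

definition window :: "nat set set \<Rightarrow> nat set" where
  "window j = {i. i \<le> 5 \<and> path_edge i \<in> j}"

lemma path_edge_window:
  assumes "j \<in> local_configs"
  shows "path_edge ` window j = j"
proof -
  have "j \<subseteq> path_edge ` {..5}" using assms path_edges_eq by (simp add: local_configs_def)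
  then show ?thesis by (auto simp: window_def)
qed

lemma card_window:
  assumes "j \<in> local_configs"
  shows "card (window j) = card j"
  using path_edge_window[OF assms] card_image[OF inj_on_subset[OF inj_path_edge]]
  by (metis subset_UNIV)

lemma window_in_path_indep:
  assumes "j \<in> local_configs"
  shows "window j \<in> path_indep 0 5 (0 \<in> window j) (5 \<in> window j)"
proof -
  have "\<not> (i \<in> window j \<and> Suc i \<in> window j)" if "i < 5" for i
  proof
    assume i: "i \<in> window j \<and> Suc i \<in> window j"
    have sub: "{path_edge i, path_edge (Suc i)} \<subseteq> {e \<in> j. Suc i \<in> e}"
      using i by (auto simp: window_def path_edge_def)
    have "finite j" using assms finite_subset[of j path_edges]
      by (auto simp: local_configs_def path_edges_def)
    then have "card {path_edge i, path_edge (Suc i)} \<le> card {e \<in> j. Suc i \<in> e}"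
      using card_mono[OF _ sub] by simp
    moreover have "path_edge i \<noteq> path_edge (Suc i)" using inj_path_edge by (simp add: inj_eq)
    moreover have "card {e \<in> j. Suc i \<in> e} \<le> 1"
      using assms that by (auto simp: local_configs_def)
    ultimately show False by simp
  qed
  then show ?thesis by (auto simp: path_indep_def window_def)
qed

lemma num_endmost_window:
  assumes "j \<in> local_configs"
  shows "num_endmost j = of_bool (0 \<in> window j) + of_bool (5 \<in> window j)"
proof -
  have "num_endmost j = card (path_edge ` (window j \<inter> {0, 5}))"
    unfolding image_Int[OF inj_path_edge] path_edge_window[OF assms]
    by (simp add: num_endmost_def path_edge_def)
  also have "\<dots> = card (window j \<inter> {0, 5})"
    by (rule card_image) (rule inj_on_subset[OF inj_path_edge], simp)
  also have "\<dots> = of_bool (0 \<in> window j) + of_bool (5 \<in> window j)"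
    by (cases "0 \<in> window j"; cases "5 \<in> window j") (simp_all add: Int_insert_right)
  finally show ?thesis .
qed

lemma has_local_config_iff:
  assumes "7 \<le> L" "S \<subseteq> {..<L}" "j \<in> local_configs"
  shows "has_local_config L (edge L ` S) j \<longleftrightarrow> S \<inter> {..5} = window j"
proof -
  have *: "embed_edges L (path_edge ` X) = edge L ` X" for X
    unfolding embed_edges_def image_image
    by (rule image_cong) (auto simp: path_edge_def edge_def)
  have inj: "inj_on (edge L) {..<L}" using assms by (simp add: inj_on_edge)
  have W: "window j \<subseteq> {..<L}" "{..5} \<subseteq> {..<L}" using assms by (auto simp: window_def)
  have "has_local_config L (edge L ` S) j \<longleftrightarrow> edge L ` S \<inter> edge L ` {..5} = edge L ` window j"
    unfolding has_local_config_def path_edges_eq * 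
    using *[of "window j"] path_edge_window[OF assms(3)] by simp
  also have "edge L ` S \<inter> edge L ` {..5} = edge L ` (S \<inter> {..5})"
    using inj_on_image_Int[OF inj assms(2) W(2)] by simp
  also have "edge L ` (S \<inter> {..5}) = edge L ` window j \<longleftrightarrow> S \<inter> {..5} = window j"
    using inj_on_image_eq_iff[OF inj, of "S \<inter> {..5}" "window j"] W assms(2) by blast
  finally show ?thesis .
qed

section \<open>Cyclic sums and the linear system of an odd cycle\<close>

definition cpred :: "nat \<Rightarrow> nat \<Rightarrow> nat" where
  "cpred L i = (if i = 0 then L - 1 else i - 1)"

lemma cpred_less: "i < L \<Longrightarrow> cpred L i < L"
  by (auto simp: cpred_def)

lemma sum_cyclic_shift:
  "(\<Sum>i<L. f i (Suc i mod L)) = (\<Sum>i<L. f (cpred L i) i :: 'a :: comm_monoid_add)"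
proof (cases L)
  case (Suc M)
  have "(\<Sum>i<L. f i (Suc i mod L)) = (\<Sum>i<M. f i (Suc i)) + f M 0"
    unfolding Suc by simp
  also have "\<dots> = (\<Sum>i<L. f (cpred L i) i)"
    unfolding Suc sum.lessThan_Suc_shift by (simp add: cpred_def add.commute)
  finally show ?thesis .
qed simp

text \<open>The recursion determines x from its initial value, but going round the cycle once has to
  close up. The homogeneous solution (-1)^i changes sign after an odd number of steps, which leaves
  exactly the freedom required.\<close>

lemma odd_cycle_solve:
  fixes r :: "nat \<Rightarrow> real"
  assumes "odd L"
  shows "\<exists>x. \<forall>i<L. x (Suc i) + x (if i = 0 then L else i) = r i"
proof -
  define y0 where "y0 = rec_nat 0 (\<lambda>i u. r i - u)"
  have y0: "y0 0 = 0" "\<And>i. y0 (Suc i) = r i - y0 i" by (simp_all add: y0_def)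
  \<comment> \<open>Adding c * (-1)^i to \<open>y0\<close> gives c at 0 and \<open>y0 L\<close> - c
    at L; these agree for c = \<open>y0 L\<close> / 2.\<close>
  define x where "x i = y0 i + (-1) ^ i * (y0 L / 2)" for i
  have "x L = x 0" using assms y0(1) by (simp add: x_def)
  moreover have "x (Suc i) + x i = r i" for i by (simp add: x_def y0(2))
  ultimately have "\<forall>i<L. x (Suc i) + x (if i = 0 then L else i) = r i" by simp
  then show ?thesis by blast
qed

lemma odd_cycle_kernel:
  fixes x :: "nat \<Rightarrow> real"
  assumes "odd L" and eq: "\<And>i. i < L \<Longrightarrow> x (Suc i) + x (if i = 0 then L else i) = 0"
    and "0 < v" "v \<le> L"
  shows "x v = 0"
proof -
  have *: "x v = (-1) ^ v * x L" if "0 < v" "v \<le> L" for v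
    using that
  proof (induction v)
    case (Suc v)
    show ?case using Suc eq[of v] by (cases "v = 0") auto
  qed simp
  have "x L = - x L" using *[of L] assms by simp
  then show ?thesis using *[of v] assms by simp
qed

text \<open>Covering v is written as a sum of two indicators instead of a disjunction. On a tile at
  most one of them is 1, and the sum is linear in the edge indicators.\<close>

definition incid :: "nat \<Rightarrow> nat set \<Rightarrow> nat \<Rightarrow> real" where
  "incid L S v = (if v = 0 then real L - 2 * real (card S)
     else of_bool (v - 1 \<in> S) + of_bool (v mod L \<in> S))"

lemma card_eq_sum_of_bool: "S \<subseteq> {..<L::nat} \<Longrightarrow> real (card S) = (\<Sum>i<L. of_bool (i \<in> S))"
  using sum.inter_restrict[of "{..<L}" "\<lambda>_. 1 :: real" S] by (simp add: Int_absorb1 of_bool_def)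

text \<open>Change from the rows of the incidence matrix to the constant 1 and the edge indicators.
  Each edge collects the weights of its two end vertices; row 0 supplies the constant and subtracts
  twice its own weight from every edge.\<close>

lemma sum_incid:
  assumes "S \<subseteq> {..<L}"
  shows "(\<Sum>v<Suc L. incid L S v * x v)
    = real L * x 0 + (\<Sum>i<L. of_bool (i \<in> S) * (x (Suc i) + x (if i = 0 then L else i) - 2 * x 0))"
proof -
  have "(\<Sum>i<L. x (Suc i) * of_bool (Suc i mod L \<in> S))
      = (\<Sum>i<L. x (Suc (cpred L i)) * of_bool (i \<in> S))"
    by (rule sum_cyclic_shift[of "\<lambda>i i'. x (Suc i) * of_bool (i' \<in> S)"])
  also have "\<dots> = (\<Sum>i<L. x (if i = 0 then L else i) * of_bool (i \<in> S))"
    by (rule sum.cong) (auto simp: cpred_def)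
  finally have *: "(\<Sum>i<L. x (Suc i) * of_bool (Suc i mod L \<in> S)) = \<dots>" .
  have "(\<Sum>v<Suc L. incid L S v * x v) = (real L - 2 * real (card S)) * x 0
      + ((\<Sum>i<L. x (Suc i) * of_bool (i \<in> S)) + (\<Sum>i<L. x (Suc i) * of_bool (Suc i mod L \<in> S)))"
    unfolding sum.lessThan_Suc_shift sum.distrib[symmetric]
    by (simp add: incid_def algebra_simps)
  moreover have "(\<Sum>i<L. of_bool (i \<in> S) * (x (Suc i) + x (if i = 0 then L else i) - 2 * x 0))
      = (\<Sum>i<L. x (Suc i) * of_bool (i \<in> S)) + (\<Sum>i<L. x (if i = 0 then L else i) * of_bool (i \<in> S))
        - 2 * x 0 * real (card S)"
    unfolding card_eq_sum_of_bool[OF assms] sum_distrib_left sum.distrib[symmetric] sum_subtractf[symmetric]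
    by (rule sum.cong) (simp_all add: algebra_simps)
  ultimately show ?thesis
    unfolding * by (simp add: left_diff_distrib)
qed

section \<open>Matrix entries and products as sums over independent sets\<close>

lemma card_tiles: "3 \<le> L \<Longrightarrow> card (tiles L) = card (cycle_indep L)"
  using bij_betw_same_card[OF bij_betw_tiles] by simp

lemma finite_tiles: "3 \<le> L \<Longrightarrow> finite (tiles L)"
  using bij_betw_finite[OF bij_betw_tiles] by simp

definition tile_sites :: "nat \<Rightarrow> nat \<Rightarrow> nat set" where
  "tile_sites L c = {i. i < L \<and> edge L i \<in> from_nat_into (tiles L) c}"

lemma tile_sites:
  assumes "3 \<le> L" "c < card (tiles L)"
  shows "tile_sites L c \<in> cycle_indep L" "from_nat_into (tiles L) c = edge L ` tile_sites L c"
proof -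
  have "tiles L \<noteq> {}" using assms by auto
  then have "from_nat_into (tiles L) c \<in> (`) (edge L) ` cycle_indep L"
    using from_nat_into bij_betw_imp_surj_on[OF bij_betw_tiles[OF assms(1)]] by simp
  then obtain S where S: "S \<in> cycle_indep L" "from_nat_into (tiles L) c = edge L ` S" by (rule imageE)
  then have "S \<subseteq> {..<L}" by (simp add: cycle_indep_def)
  then have "edge L i \<in> edge L ` S \<longleftrightarrow> i \<in> S" if "i < L" for i
    using that inj_on_image_mem_iff[OF inj_on_edge[OF assms(1)], of i S] by simp
  then have "tile_sites L c = S"
    using \<open>S \<subseteq> {..<L}\<close> unfolding tile_sites_def S(2) by blast
  then show "tile_sites L c \<in> cycle_indep L" "from_nat_into (tiles L) c = edge L ` tile_sites L c"
    using S by simp_all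
qed

lemma bij_betw_tile_sites:
  assumes "3 \<le> L"
  shows "bij_betw (tile_sites L) {..<card (tiles L)} (cycle_indep L)"
proof (rule bij_betw_imageI)
  have g: "bij_betw (from_nat_into (tiles L)) {..<card (tiles L)} (tiles L)"
    by (rule bij_betw_from_nat_into_finite[OF finite_tiles[OF assms]])
  note h = bij_betw_tiles[OF assms]
  show "inj_on (tile_sites L) {..<card (tiles L)}"
  proof (rule inj_onI)
    fix c d assume *: "c \<in> {..<card (tiles L)}" "d \<in> {..<card (tiles L)}" "tile_sites L c = tile_sites L d"
    then have "from_nat_into (tiles L) c = from_nat_into (tiles L) d"
      using tile_sites(2)[OF assms, of c] tile_sites(2)[OF assms, of d] by simp
    then show "c = d" using inj_onD[OF bij_betw_imp_inj_on[OF g]] * by blast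
  qed
  show "tile_sites L ` {..<card (tiles L)} = cycle_indep L"
  proof (intro equalityI subsetI)
    fix S assume S: "S \<in> cycle_indep L"
    then have "edge L ` S \<in> tiles L" using bij_betwE[OF h] by blast
    then obtain c where c: "c < card (tiles L)" "from_nat_into (tiles L) c = edge L ` S"
      using bij_betw_imp_surj_on[OF g] by (metis imageE lessThan_iff)
    then have "edge L ` tile_sites L c = edge L ` S"
      using tile_sites(2)[OF assms c(1)] by simp
    then have "tile_sites L c = S"
      using inj_onD[OF bij_betw_imp_inj_on[OF h] _ tile_sites(1)[OF assms c(1)] S] by blast
    then show "S \<in> tile_sites L ` {..<card (tiles L)}" using c(1) by blast
  next
    fix S assume "S \<in> tile_sites L ` {..<card (tiles L)}"
    then obtain c where "c < card (tiles L)" "S = tile_sites L c" by blast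
    then show "S \<in> cycle_indep L" using tile_sites(1)[OF assms, of c] by simp
  qed
qed

lemma sum_tile_sites:
  assumes "3 \<le> L"
  shows "(\<Sum>c<card (tiles L). f (tile_sites L c)) = (\<Sum>S\<in>cycle_indep L. f S)"
  by (rule sum.reindex_bij_betw[OF bij_betw_tile_sites[OF assms]])

lemma incidence_mat_entry:
  assumes "3 \<le> L" "c < card (tiles L)" "v < Suc L"
  shows "incidence_mat L $$ (v, c) = incid L (tile_sites L c) v"
proof -
  let ?S = "tile_sites L c"
  have S: "?S \<in> cycle_indep L" and t: "from_nat_into (tiles L) c = edge L ` ?S"
    by (rule tile_sites[OF assms(1,2)])+
  from S have sub: "?S \<subseteq> {..<L}" by (simp add: cycle_indep_def)
  have "card (edge L ` ?S) = card ?S"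
    by (rule card_image, rule inj_on_subset[OF inj_on_edge[OF assms(1)] sub])
  moreover have "v \<in> \<Union> (edge L ` ?S) \<longleftrightarrow> v - 1 \<in> ?S \<or> v mod L \<in> ?S" if "v \<noteq> 0"
    using mem_Union_edges_iff[of v L ?S] sub that assms by auto
  moreover have "\<not> (v - 1 \<in> ?S \<and> v mod L \<in> ?S)" if "v \<noteq> 0"
    using S that assms by (cases v) (auto simp: cycle_indep_def)
  moreover have "incidence_mat L $$ (v, c) = (if v = 0 then real L - 2 * real (card (edge L ` ?S))
      else if v \<in> \<Union> (edge L ` ?S) then 1 else 0)"
    using assms(2,3) by (simp add: incidence_mat_def Let_def flip: t)
  ultimately show ?thesis
    by (cases "v = 0"; cases "v - 1 \<in> ?S"; cases "v mod L \<in> ?S") (simp_all only: incid_def, simp_all)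
qed

lemma finite_local_configs: "finite local_configs"
proof (rule finite_subset)
  show "local_configs \<subseteq> Pow path_edges" unfolding local_configs_def by blast
qed (simp add: path_edges_def)

lemma to_nat_on_local_configs_less:
  assumes "j \<in> local_configs"
  shows "to_nat_on local_configs j < card local_configs"
  using bij_betwE[OF to_nat_on_finite[OF finite_local_configs]] assms by blast

lemma config_mat_entry:
  assumes "7 \<le> L" "c < card (tiles L)" "j \<in> local_configs"
  shows "config_mat L $$ (to_nat_on local_configs j, c)
    = of_bool (tile_sites L c \<inter> {..5} = window j)"
proof -
  have "from_nat_into local_configs (to_nat_on local_configs j) = j"
    by (rule from_nat_into_to_nat_on[OF countable_finite[OF finite_local_configs] assms(3)])
  moreover have "tile_sites L c \<in> cycle_indep L" using tile_sites(1)[of L c] assms by simp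
  ultimately show ?thesis
    using has_local_config_iff[OF assms(1) _ assms(3), of "tile_sites L c"] assms to_nat_on_local_configs_less[OF assms(3)]
      tile_sites(2)[of L c] by (simp add: config_mat_def cycle_indep_def)
qed

definition window_ind :: "nat set set \<Rightarrow> nat set \<Rightarrow> real" where
  "window_ind j S = of_bool (S \<inter> {..5} = window j)"

lemma incidence_mat_carrier: "incidence_mat L \<in> carrier_mat (Suc L) (card (tiles L))"
  by (simp add: incidence_mat_def)

lemma config_mat_carrier: "config_mat L \<in> carrier_mat (card local_configs) (card (tiles L))"
  by (simp add: config_mat_def)

lemma transpose_incidence_mat_mult_vec:
  assumes "3 \<le> L" "c < card (tiles L)" "v \<in> carrier_vec (Suc L)"
  shows "(transpose_mat (incidence_mat L) *\<^sub>v v) $ c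
    = (\<Sum>u<Suc L. incid L (tile_sites L c) u * v $ u)"
  using assms incidence_mat_carrier[of L]
  by (auto simp: scalar_prod_def incidence_mat_entry atLeast0LessThan simp del: sum.lessThan_Suc intro!: sum.cong)

lemma incidence_mat_mult_vec:
  assumes "3 \<le> L" "u < Suc L"
  shows "(incidence_mat L *\<^sub>v vec (card (tiles L)) (\<lambda>c. f (tile_sites L c))) $ u
    = (\<Sum>S\<in>cycle_indep L. incid L S u * f S)"
proof -
  have "(incidence_mat L *\<^sub>v vec (card (tiles L)) (\<lambda>c. f (tile_sites L c))) $ u
      = (\<Sum>c<card (tiles L). incid L (tile_sites L c) u * f (tile_sites L c))"
    using assms incidence_mat_carrier[of L]
    by (auto simp: scalar_prod_def incidence_mat_entry atLeast0LessThan intro!: sum.cong)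
  then show ?thesis using sum_tile_sites[OF assms(1), of "\<lambda>S. incid L S u * f S"] by simp
qed

lemma row_config_mat:
  assumes "7 \<le> L" "j \<in> local_configs"
  shows "row (config_mat L) (to_nat_on local_configs j)
    = vec (card (tiles L)) (\<lambda>c. window_ind j (tile_sites L c))"
  using assms config_mat_carrier[of L] to_nat_on_local_configs_less[OF assms(2)]
  by (intro eq_vecI) (auto simp: config_mat_entry window_ind_def)

text \<open>Every row of the incidence matrix is a combination of 1 and the edge indicators. The
  normal equations therefore reduce to orthogonality to these functions.\<close>

lemma sum_incid_mult_eq_0:
  assumes "u < Suc L"
    and H0: "(\<Sum>S\<in>cycle_indep L. f S) = 0"
    and H: "\<And>k. k < L \<Longrightarrow> (\<Sum>S\<in>cycle_indep L. of_bool (k \<in> S) * f S) = 0"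
  shows "(\<Sum>S\<in>cycle_indep L. incid L S u * f S) = 0"
proof (cases "u = 0")
  case True
  have "(\<Sum>S\<in>cycle_indep L. incid L S u * f S)
      = (\<Sum>S\<in>cycle_indep L. real L * f S - 2 * (\<Sum>i<L. of_bool (i \<in> S) * f S))"
  proof (rule sum.cong)
    fix S assume "S \<in> cycle_indep L"
    then have "S \<subseteq> {..<L}" by (simp add: cycle_indep_def)
    then show "incid L S u * f S = real L * f S - 2 * (\<Sum>i<L. of_bool (i \<in> S) * f S)"
      unfolding sum_distrib_right[symmetric] card_eq_sum_of_bool[OF \<open>S \<subseteq> {..<L}\<close>, symmetric]
      using True by (simp add: incid_def algebra_simps)
  qed simp
  also have "\<dots> = real L * (\<Sum>S\<in>cycle_indep L. f S) - 2 * (\<Sum>i<L. \<Sum>S\<in>cycle_indep L. of_bool (i \<in> S) * f S)"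
    using sum.swap[of "\<lambda>S i. of_bool (i \<in> S) * f S" "{..<L}" "cycle_indep L"]
    by (simp only: sum_subtractf sum_distrib_left[symmetric])
  finally show ?thesis using H0 H by simp
next
  case False
  then have "(\<Sum>S\<in>cycle_indep L. incid L S u * f S)
      = (\<Sum>S\<in>cycle_indep L. of_bool (u - 1 \<in> S) * f S) + (\<Sum>S\<in>cycle_indep L. of_bool (u mod L \<in> S) * f S)"
    unfolding sum.distrib[symmetric] by (simp add: incid_def ring_distribs)
  then show ?thesis using H[of "u - 1"] H[of "u mod L"] False assms(1) by simp
qed

lemma cycle_indep_empty [simp]: "{} \<in> cycle_indep L"
  by (simp add: cycle_indep_def)

lemma cycle_indep_singleton: "2 \<le> L \<Longrightarrow> i < L \<Longrightarrow> {i} \<in> cycle_indep L"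
  by (cases "Suc i = L") (auto simp: cycle_indep_def)

section \<open>Mean and variance without matrices\<close>

lemma expectation_S_eq:
  assumes "7 \<le> L" "j \<in> local_configs"
  shows "expectation_S N L j = real N / real (card (cycle_indep L)) * (\<Sum>S\<in>cycle_indep L. window_ind j S)"
proof -
  have "(config_mat L *\<^sub>v vec (card (tiles L)) (\<lambda>_. 1)) $ to_nat_on local_configs j
      = (\<Sum>c<card (tiles L). window_ind j (tile_sites L c))"
    using config_mat_carrier[of L] to_nat_on_local_configs_less[OF assms(2)]
    by (simp add: row_config_mat[OF assms] scalar_prod_def atLeast0LessThan)
  moreover have "3 \<le> L" using assms by simp
  ultimately show ?thesis
    using config_mat_carrier[of L] to_nat_on_local_configs_less[OF assms(2)]
      sum_tile_sites[of L "window_ind j"]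
    by (simp add: expectation_S_def mean_S_def card_tiles)
qed

text \<open>An affine function \<open>p\<close> of the edge indicators whose residual is orthogonal
  to 1 and to all edge indicators is the projection of the indicator of j. Oddness enters twice: in
  writing \<open>p\<close> through the rows of the incidence matrix, and in the independence of
  these rows.\<close>

lemma variance_S_eq:
  fixes \<beta> :: "nat \<Rightarrow> real"
  assumes L: "7 \<le> L" "odd L" and j: "j \<in> local_configs"
    and p: "\<And>S. S \<in> cycle_indep L \<Longrightarrow> p S = \<alpha> + (\<Sum>i<L. of_bool (i \<in> S) * \<beta> i)"
    and H0: "(\<Sum>S\<in>cycle_indep L. window_ind j S - p S) = 0"
    and H: "\<And>k. k < L \<Longrightarrow> (\<Sum>S\<in>cycle_indep L. of_bool (k \<in> S) * (window_ind j S - p S)) = 0"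
  shows "variance_S N L j = real N / real (card (cycle_indep L))
    * ((\<Sum>S\<in>cycle_indep L. window_ind j S) - (\<Sum>S\<in>cycle_indep L. window_ind j S * p S))"
proof -
  define D B r n where "D = incidence_mat L" and "B = config_mat L"
    and "r = to_nat_on local_configs j" and "n = card (tiles L)"
  have L3: "3 \<le> L" using L by simp
  have D: "D \<in> carrier_mat (Suc L) n" and B: "B \<in> carrier_mat (card local_configs) n"
    by (simp_all add: D_def B_def n_def incidence_mat_carrier config_mat_carrier)
  have r: "r < card local_configs" using j by (simp add: r_def to_nat_on_local_configs_less)
  have row: "row B r = vec n (\<lambda>c. window_ind j (tile_sites L c))"
    unfolding B_def r_def n_def by (rule row_config_mat[OF L(1) j])
  \<comment> \<open>The weight \<alpha> / L of row 0 produces the constant \<alpha>, but also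
    subtracts 2\<alpha> / L from every edge; the added term compensates for this.\<close>
  obtain y where y: "\<And>i. i < L \<Longrightarrow> y (Suc i) + y (if i = 0 then L else i) = \<beta> i + 2 * \<alpha> / real L"
    using odd_cycle_solve[OF L(2), of "\<lambda>i. \<beta> i + 2 * \<alpha> / real L"] by blast
  define x where "x = vec (Suc L) (\<lambda>v. if v = 0 then \<alpha> / real L else y v)"
  have x: "x \<in> carrier_vec (Suc L)" by (simp add: x_def)
  have Tx: "transpose_mat D *\<^sub>v x = vec n (\<lambda>c. p (tile_sites L c))"
  proof (rule eq_vecI)
    fix c assume "c < dim_vec (vec n (\<lambda>c. p (tile_sites L c)))"
    then have c: "c < n" by simp
    have S: "tile_sites L c \<in> cycle_indep L" using tile_sites(1)[OF L3] c by (simp add: n_def)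
    then have sub: "tile_sites L c \<subseteq> {..<L}" by (simp add: cycle_indep_def)
    have "(transpose_mat D *\<^sub>v x) $ c = (\<Sum>u<Suc L. incid L (tile_sites L c) u * x $ u)"
      unfolding D_def using transpose_incidence_mat_mult_vec[OF L3 _ x] c by (simp only: n_def)
    also have "\<dots> = real L * x $ 0 + (\<Sum>i<L. of_bool (i \<in> tile_sites L c)
        * (x $ (Suc i) + x $ (if i = 0 then L else i) - 2 * x $ 0))"
      by (rule sum_incid[OF sub])
    also have "\<dots> = \<alpha> + (\<Sum>i<L. of_bool (i \<in> tile_sites L c) * \<beta> i)"
    proof (intro arg_cong2[of _ _ _ _ "(+)"] sum.cong)
      fix i assume i: "i \<in> {..<L}"
      then have "x $ (Suc i) + x $ (if i = 0 then L else i) - 2 * x $ 0 = \<beta> i"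
        using y[of i] L3 by (simp add: x_def split: if_splits)
      then show "of_bool (i \<in> tile_sites L c) * (x $ (Suc i) + x $ (if i = 0 then L else i) - 2 * x $ 0)
          = of_bool (i \<in> tile_sites L c) * \<beta> i" by simp
    qed (use L3 in \<open>simp_all add: x_def\<close>)
    finally show "(transpose_mat D *\<^sub>v x) $ c = vec n (\<lambda>c. p (tile_sites L c)) $ c"
      using p[OF S] c by simp
  qed (use D in simp)
  have "D *\<^sub>v row B r = D *\<^sub>v (transpose_mat D *\<^sub>v x)"
  proof (rule eq_vecI)
    fix u assume "u < dim_vec (D *\<^sub>v (transpose_mat D *\<^sub>v x))"
    then have u: "u < Suc L" using D by simp
    have "(\<Sum>S\<in>cycle_indep L. incid L S u * (window_ind j S - p S)) = 0"
      by (rule sum_incid_mult_eq_0[OF u H0 H])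
    then have "(\<Sum>S\<in>cycle_indep L. incid L S u * window_ind j S) = (\<Sum>S\<in>cycle_indep L. incid L S u * p S)"
      by (simp add: right_diff_distrib sum_subtractf)
    then show "(D *\<^sub>v row B r) $ u = (D *\<^sub>v (transpose_mat D *\<^sub>v x)) $ u"
      unfolding Tx row unfolding D_def n_def incidence_mat_mult_vec[OF L3 u] .
  qed simp
  \<comment> \<open>Independence of the rows: the empty tile isolates the weight of row 0, and the
    tiles with a single edge then give the homogeneous system of the odd cycle.\<close>
  moreover have "v = 0\<^sub>v (Suc L)" if v: "v \<in> carrier_vec (Suc L)" "transpose_mat D *\<^sub>v v = 0\<^sub>v n" for v
  proof -
    have sum0: "real L * v $ 0 + (\<Sum>i<L. of_bool (i \<in> S)
        * (v $ (Suc i) + v $ (if i = 0 then L else i) - 2 * v $ 0)) = 0" if S: "S \<in> cycle_indep L" for S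
    proof -
      have "S \<in> tile_sites L ` {..<n}"
        using bij_betw_imp_surj_on[OF bij_betw_tile_sites[OF L3]] S by (simp add: n_def)
      then obtain c where c: "c < n" "tile_sites L c = S" by auto
      have "S \<subseteq> {..<L}" using S by (simp add: cycle_indep_def)
      from sum_incid[OF this, of "\<lambda>u. v $ u"]
      show ?thesis
        using transpose_incidence_mat_mult_vec[OF L3 _ v(1), of c] v(2) c by (simp add: n_def D_def)
    qed
    have v0: "v $ 0 = 0" using sum0[OF cycle_indep_empty] L by simp
    have "v $ (Suc i) + v $ (if i = 0 then L else i) = 0" if "i < L" for i
    proof -
      have "(\<Sum>k<L. of_bool (k \<in> {i}) * (v $ (Suc k) + v $ (if k = 0 then L else k) - 2 * v $ 0))
          = (\<Sum>k<L. if k = i then v $ (Suc k) + v $ (if k = 0 then L else k) else 0)"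
        using v0 by (intro sum.cong) auto
      then show ?thesis using sum0[OF cycle_indep_singleton, of i] that L v0 by simp
    qed
    then have "v $ u = 0" if "0 < u" "u \<le> L" for u
      using odd_cycle_kernel[OF L(2), of "\<lambda>u. v $ u"] that by blast
    then have "v $ u = 0" if "u < Suc L" for u
      using v0 that by (cases "u = 0") auto
    then show ?thesis using v(1) by (intro eq_vecI) auto
  qed
  ultimately have quad: "(B * transpose_mat D * the (mat_inverse (D * transpose_mat D)) * D * transpose_mat B) $$ (r, r)
      = row B r \<bullet> vec n (\<lambda>c. p (tile_sites L c))"
    using quad_form_inverse[OF D B r _ x] Tx by simp
  have 1: "row B r \<bullet> vec n (\<lambda>c. p (tile_sites L c)) = (\<Sum>S\<in>cycle_indep L. window_ind j S * p S)"
    unfolding row using sum_tile_sites[OF L3, of "\<lambda>S. window_ind j S * p S"]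
    by (simp add: scalar_prod_def atLeast0LessThan n_def)
  have "(\<Sum>c<card (tiles L). window_ind j (tile_sites L c) * window_ind j (tile_sites L c)) = (\<Sum>S\<in>cycle_indep L. window_ind j S)"
    using sum_tile_sites[OF L3, of "\<lambda>S. window_ind j S * window_ind j S"] by (simp add: window_ind_def)
  then have 2: "(B * transpose_mat B) $$ (r, r) = (\<Sum>S\<in>cycle_indep L. window_ind j S)"
    using B r row by (simp add: scalar_prod_def atLeast0LessThan n_def)
  show ?thesis
    using B D r quad 1 2
    by (simp add: variance_S_def cov_S_def Let_def card_tiles[OF L3] flip: B_def D_def r_def)
qed

section \<open>The projection onto the row space\<close>

lemma sum_cycle_indep_of_bool: "(\<Sum>S\<in>cycle_indep L. of_bool (P S)) = real (card {S \<in> cycle_indep L. P S})"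
  by (simp add: Int_def)

lemma sum_cycle_indep_site:
  assumes "2 \<le> L" "i < L"
  shows "(\<Sum>S\<in>cycle_indep L. of_bool (i \<in> S)) = real (fibp L)"
  using sum_cycle_indep_of_bool[of "\<lambda>S. i \<in> S" L] card_cycle_indep_one[OF assms] by simp

text \<open>The plain distance suffices in place of the cyclic one, because it enters through
  \<open>fibp d * fibp (L - d)\<close>, which is invariant under replacing d by L - d.\<close>

definition ndist :: "nat \<Rightarrow> nat \<Rightarrow> nat" where
  "ndist i k = (i - k) + (k - i)"

lemma sum_cycle_indep_two_sites:
  assumes "2 \<le> L" "i < L" "k < L"
  shows "(\<Sum>S\<in>cycle_indep L. of_bool (k \<in> S) * of_bool (i \<in> S)) = real (fibp (ndist i k) * fibp (L - ndist i k))"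
proof -
  have "(\<Sum>S\<in>cycle_indep L. of_bool (k \<in> S) * of_bool (i \<in> S)) = real (card {S \<in> cycle_indep L. k \<in> S \<and> i \<in> S})"
    using sum_cycle_indep_of_bool[of "\<lambda>S. k \<in> S \<and> i \<in> S" L] by (simp only: of_bool_conj)
  also have "card {S \<in> cycle_indep L. k \<in> S \<and> i \<in> S} = fibp (ndist i k) * fibp (L - ndist i k)"
  proof (cases "k \<le> i")
    case True
    then show ?thesis using card_cycle_indep_two[of L k i] assms by (simp add: ndist_def)
  next
    case False
    then show ?thesis using card_cycle_indep_two[of L i k] assms by (simp add: ndist_def conj_commute)
  qed
  finally show ?thesis .
qed

text \<open>By Binet's formula the product \<open>fibp a * fibp b\<close> with a + b fixed is a
  constant plus geometric modes of ratio -\<phi>^2 and its inverse, which the weights 1, 3, 1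
  annihilate. The proof stays within the natural numbers by expanding the right-hand side with
  \<open>fibp_add\<close>.\<close>

lemma fibp_tridiagonal:
  assumes "1 \<le> a" "1 \<le> b"
  shows "fibp (a - 1) * fibp (b + 1) + 3 * (fibp a * fibp b) + fibp (a + 1) * fibp (b - 1) = fibp (a + b) + fibp (a + b - 2)"
proof -
  obtain a' b' where ab: "a = Suc a'" "b = Suc b'"
    using assms by (metis Suc_le_D One_nat_def)
  have "fibp (a + b) = fibp (Suc a') * fibp (Suc b') + fibp (Suc (Suc a')) * fibp (Suc (Suc b'))"
    using fibp_add[of "Suc a'" "Suc b'"] by (simp only: ab)
  moreover have "fibp (a + b - 2) = fibp a' * fibp b' + fibp (Suc a') * fibp (Suc b')"
    using fibp_add[of a' b'] by (simp add: ab)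
  ultimately show ?thesis by (simp add: ab algebra_simps)
qed

text \<open>Up to a factor and a multiple of the all-ones matrix, this operator inverts the covariance
  matrix of the edge indicators (lemma \<open>sum_cycle_indep_tridiag_site\<close>).\<close>

definition tridiag :: "nat \<Rightarrow> (nat \<Rightarrow> real) \<Rightarrow> nat \<Rightarrow> real" where
  "tridiag L f i = f (cpred L i) + 3 * f i + f (Suc i mod L)"

text \<open>For i \<noteq> k this is \<open>fibp_tridiagonal\<close> with a = d and b = L - d, where
  the symmetry of \<open>h\<close> takes care of the wrap-around. For i = k both neighbours
  contribute 0, as \<open>fibp 1 = 0\<close>, and the remaining \<open>3 * fibp L\<close> exceeds
  the constant by \<open>fibp (L + 1)\<close>.\<close>

lemma tridiag_two_sites:
  assumes "3 \<le> L" "i < L" "k < L"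
  shows "tridiag L (\<lambda>i. real (fibp (ndist i k) * fibp (L - ndist i k))) i
    = real (fibp L) + real (fibp (L - 2)) + (if i = k then real (fibp (L + 1)) else 0)"
proof -
  define h where "h d = fibp d * fibp (L - d)" for d
  have sym: "h (L - d) = h d" if "d \<le> L" for d
    using that by (simp add: h_def mult.commute)
  have mid: "h (d - 1) + 3 * h d + h (d + 1) = fibp L + fibp (L - 2)" if "1 \<le> d" "d < L" for d
  proof -
    have "L - (d - 1) = L - d + 1" "L - (d + 1) = L - d - 1" "d + (L - d) = L" using that by auto
    then show ?thesis using fibp_tridiagonal[of d "L - d"] that by (simp only: h_def)
  qed
  have "h (ndist (cpred L i) k) + 3 * h (ndist i k) + h (ndist (Suc i mod L) k)
      = fibp L + fibp (L - 2) + (if i = k then fibp (L + 1) else 0)"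
  proof -
    consider "i = k" | "i < k" | "k < i" by linarith
    then show ?thesis
    proof cases
      case 1
      have h1: "h 1 = 0" "h (L - 1) = 0" using sym[of 1] assms by (simp_all add: h_def)
      have "h (ndist (cpred L i) k) = 0" "h (ndist (Suc i mod L) k) = 0"
        using h1 1 assms by (auto simp: ndist_def cpred_def mod_Suc)
      moreover obtain l where "L = Suc (Suc l)" using assms(1) by (metis Suc_le_D numeral_3_eq_3 Suc_le_mono)
      ultimately show ?thesis using 1 by (simp add: h_def ndist_def)
    next
      case 2
      define d where "d = k - i"
      have d: "1 \<le> d" "d < L" "ndist i k = d" using 2 assms by (auto simp: d_def ndist_def)
      have "ndist (Suc i mod L) k = d - 1" using 2 assms by (auto simp: d_def ndist_def mod_Suc)
      moreover have "h (ndist (cpred L i) k) = h (d + 1)"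
      proof (cases "i = 0")
        case True
        then have "ndist (cpred L i) k = L - (d + 1)" using 2 assms by (auto simp: d_def ndist_def cpred_def)
        then show ?thesis using sym[of "d + 1"] d by simp
      next
        case False
        then have "ndist (cpred L i) k = d + 1" using 2 assms by (auto simp: d_def ndist_def cpred_def)
        then show ?thesis by simp
      qed
      ultimately show ?thesis using mid[OF d(1,2)] d(3) 2 by simp
    next
      case 3
      define d where "d = i - k"
      have d: "1 \<le> d" "d < L" "ndist i k = d" using 3 assms by (auto simp: d_def ndist_def)
      have "ndist (cpred L i) k = d - 1" using 3 assms by (auto simp: d_def ndist_def cpred_def)
      moreover have "h (ndist (Suc i mod L) k) = h (d + 1)"
      proof (cases "Suc i = L")
        case True
        then have "ndist (Suc i mod L) k = L - (d + 1)" using 3 assms by (auto simp: d_def ndist_def)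
        then show ?thesis using sym[of "d + 1"] d by simp
      next
        case False
        then have "ndist (Suc i mod L) k = d + 1" using 3 assms by (auto simp: d_def ndist_def)
        then show ?thesis by simp
      qed
      ultimately show ?thesis using mid[OF d(1,2)] d(3) 3 by simp
    qed
  qed
  then have "real (h (ndist (cpred L i) k) + 3 * h (ndist i k) + h (ndist (Suc i mod L) k))
      = real (fibp L + fibp (L - 2) + (if i = k then fibp (L + 1) else 0))" by (rule arg_cong)
  then show ?thesis by (simp add: tridiag_def h_def)
qed

lemma sum_cycle_indep_tridiag:
  "(\<Sum>S\<in>cycle_indep L. g S * tridiag L (\<lambda>i. of_bool (i \<in> S)) i) = tridiag L (\<lambda>i. \<Sum>S\<in>cycle_indep L. g S * of_bool (i \<in> S)) i"
  unfolding tridiag_def sum_distrib_left sum.distrib[symmetric]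
  by (rule sum.cong) (simp_all only: ring_distribs mult.left_commute)

lemma tridiag_cong:
  assumes "i < L" "\<And>k. k < L \<Longrightarrow> f k = g k"
  shows "tridiag L f i = tridiag L g i"
  using assms cpred_less[OF assms(1)] by (simp add: tridiag_def)

lemma sum_cycle_indep_tridiag_site:
  assumes "3 \<le> L" "i < L" "k < L"
  shows "(\<Sum>S\<in>cycle_indep L. of_bool (k \<in> S) * tridiag L (\<lambda>i. of_bool (i \<in> S)) i)
    = real (fibp L) + real (fibp (L - 2)) + (if i = k then real (fibp (L + 1)) else 0)"
  unfolding sum_cycle_indep_tridiag tridiag_two_sites[OF assms, symmetric]
  using assms sum_cycle_indep_two_sites[of L _ k] by (intro tridiag_cong) auto

lemma sum_cycle_indep_tridiag_one:
  assumes "3 \<le> L" "i < L"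
  shows "(\<Sum>S\<in>cycle_indep L. tridiag L (\<lambda>i. of_bool (i \<in> S)) i) = 5 * real (fibp L)"
proof -
  have "(\<Sum>S\<in>cycle_indep L. 1 * tridiag L (\<lambda>i. of_bool (i \<in> S)) i) = tridiag L (\<lambda>_. real (fibp L)) i"
    unfolding sum_cycle_indep_tridiag using assms sum_cycle_indep_site[of L] by (intro tridiag_cong) auto
  then show ?thesis by (simp add: tridiag_def)
qed

section \<open>Tiles of a given local configuration that contain a further edge\<close>

definition site_count :: "nat set \<Rightarrow> nat \<Rightarrow> nat \<Rightarrow> nat" where
  "site_count W L i = (if i \<le> 5 then of_bool (i \<in> W) * fibp (L - 3 - of_bool (0 \<in> W) - of_bool (5 \<in> W))
     else fibp (i - 4 - of_bool (5 \<in> W)) * fibp (L - i + 1 - of_bool (0 \<in> W)))"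

lemma sum_window_ind:
  assumes "7 \<le> L" "j \<in> local_configs"
  shows "(\<Sum>S\<in>cycle_indep L. window_ind j S) = real (fibp (L - 3 - of_bool (0 \<in> window j) - of_bool (5 \<in> window j)))"
  using card_cycle_indep_window[OF _ window_in_path_indep[OF assms(2)], of L] assms
  unfolding window_ind_def sum_cycle_indep_of_bool by simp

lemma sum_window_ind_site:
  assumes "7 \<le> L" "j \<in> local_configs" "i < L"
  shows "(\<Sum>S\<in>cycle_indep L. window_ind j S * of_bool (i \<in> S)) = real (site_count (window j) L i)"
proof (cases "i \<le> 5")
  case True
  then have "i \<in> S \<longleftrightarrow> i \<in> window j" if "S \<inter> {..5} = window j" for S
    using that by auto
  then have "window_ind j S * of_bool (i \<in> S) = of_bool (i \<in> window j) * window_ind j S" for S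
    by (auto simp: window_ind_def)
  then have "(\<Sum>S\<in>cycle_indep L. window_ind j S * of_bool (i \<in> S)) = of_bool (i \<in> window j) * (\<Sum>S\<in>cycle_indep L. window_ind j S)"
    by (simp only: sum_distrib_left)
  then show ?thesis unfolding sum_window_ind[OF assms(1,2)] using True by (simp add: site_count_def)
next
  case False
  have "(\<Sum>S\<in>cycle_indep L. window_ind j S * of_bool (i \<in> S)) = real (card {S \<in> cycle_indep L. S \<inter> {..5} = window j \<and> i \<in> S})"
    unfolding window_ind_def of_bool_conj[symmetric] by (rule sum_cycle_indep_of_bool)
  then show ?thesis
    using card_cycle_indep_window_one[OF _ window_in_path_indep[OF assms(2)], of L i] assms(1,3) False
    by (simp add: site_count_def)
qed

text \<open>Outside the window the count is a product of two Fibonacci numbers whose indices have a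
  constant sum. For i = 6 and i = L - 1 one neighbour belongs to the window, but the product formula
  \<open>g\<close> remains correct there: at 5, and at L in the role of 0, one factor is
  \<open>fibp 0\<close> or \<open>fibp 1\<close> according to the state of that window end.\<close>

lemma tridiag_site_count:
  fixes W :: "nat set"
  assumes "9 \<le> L" "6 \<le> i" "i < L"
  defines "m \<equiv> L - 3 - of_bool (0 \<in> W) - of_bool (5 \<in> W)"
  shows "tridiag L (\<lambda>i. real (site_count W L i)) i = real (fibp m + fibp (m - 2))"
proof -
  define g where "g i = fibp (i - 4 - of_bool (5 \<in> W)) * fibp (L + 1 - i - of_bool (0 \<in> W))" for i
  have q1: "fibp 1 = 0" by simp
  have g5: "g 5 = of_bool (5 \<in> W) * fibp m" unfolding g_def m_def
    by (cases "5 \<in> W"; cases "0 \<in> W") simp_all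
  have gL: "g L = of_bool (0 \<in> W) * fibp m" unfolding g_def m_def using assms(1)
    by (cases "5 \<in> W"; cases "0 \<in> W") (simp_all add: diff_commute)
  have count: "site_count W L k = g k" if "5 \<le> k" "k < L" for k
    using that g5 by (cases "k = 5") (simp_all add: site_count_def g_def m_def Suc_diff_le)
  have "site_count W L (cpred L i) = g (i - 1)"
    using assms(2,3) by (subst count) (auto simp: cpred_def)
  moreover have "site_count W L (Suc i mod L) = g (i + 1)"
  proof (cases "Suc i = L")
    case True
    then show ?thesis using gL by (simp add: site_count_def m_def)
  next
    case False
    then show ?thesis using assms(2,3) count[of "Suc i"] by simp
  qed
  ultimately have "tridiag L (\<lambda>i. real (site_count W L i)) i = real (g (i - 1) + 3 * g i + g (i + 1))"
    using count[of i] assms(2,3) by (simp add: tridiag_def)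
  also have "g (i - 1) + 3 * g i + g (i + 1) = fibp m + fibp (m - 2)"
  proof -
    define a b where "a = i - 4 - of_bool (5 \<in> W)" and "b = L + 1 - i - of_bool (0 \<in> W)"
    have "a \<ge> 1" "b \<ge> 1" "a + b = m" "i - 1 - 4 - of_bool (5 \<in> W) = a - 1" "i + 1 - 4 - of_bool (5 \<in> W) = a + 1"
      "L + 1 - (i - 1) - of_bool (0 \<in> W) = b + 1" "L + 1 - (i + 1) - of_bool (0 \<in> W) = b - 1"
      using assms(1-3) by (auto simp: a_def b_def m_def split: split_of_bool)
    then show ?thesis using fibp_tridiagonal[of a b] by (simp only: g_def flip: a_def b_def)
  qed
  finally show ?thesis .
qed

text \<open>With \<open>k = 0\<close> this is a Cassini identity; for general \<open>k\<close> it bounds the only error term in the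
  variance that is multiplied by something growing with \<open>L\<close>.\<close>

lemma fibp_conserved:
  fixes k :: nat
  defines "X \<equiv> \<lambda>m. (real (fibp m) + real (fibp (m - 2))) * (real (fibp (m + k + 2)) + real (fibp (m + k)))
     - 5 * real (fibp (m + k)) * real (fibp m)"
  shows "X (n + 2) = (-1) ^ n * X 2"
proof (induction n)
  case (Suc n)
  define a b c d where "a = real (fibp n)" and "b = real (fibp (Suc n))"
    and "c = real (fibp (n + 2 + k))" and "d = real (fibp (Suc (n + 2 + k)))"
  have n: "real (fibp (n + 2)) = a + b" "real (fibp (Suc n + 2)) = a + 2 * b"
    "real (fibp (n + 2 + k + 2)) = c + d" "real (fibp (Suc n + 2 + k)) = d" "real (fibp (Suc n + 2 + k + 2)) = c + 2 * d"
    by (simp_all add: a_def b_def c_def d_def)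
  have m: "n + 2 - 2 = n" "Suc n + 2 - 2 = Suc n" by simp_all
  have "X (n + 2) = (a + b + a) * (c + d + c) - 5 * c * (a + b)"
    unfolding X_def n m by (simp add: a_def c_def)
  moreover have "X (Suc n + 2) = (a + 2 * b + b) * (c + 2 * d + d) - 5 * d * (a + 2 * b)"
    unfolding X_def n m by (simp add: b_def)
  ultimately have "X (Suc n + 2) = - X (n + 2)" by (simp add: algebra_simps)
  then show ?case using Suc by simp
qed (simp add: numeral_2_eq_2)

text \<open>The determinant of the two normal equations that couple the constant term and the sum of
  the coefficients in \<open>variance_S_exact\<close>.\<close>

lemma fibp_Cassini:
  assumes "odd L" "3 \<le> L"
  shows "real (fibp (L + 2) + fibp L) * real (fibp L + fibp (L - 2)) - 5 * real (fibp L) ^ 2 = - 1"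
proof -
  obtain n where n: "L = n + 2" "odd n" using assms by (metis add_diff_inverse_nat even_add even_numeral
    le_add_diff_inverse2 less_or_eq_imp_le linorder_not_less numeral_2_eq_2 numeral_3_eq_3 Suc_leD)
  show ?thesis using fibp_conserved[of n 0] n
    by (simp add: eval_nat_numeral algebra_simps)
qed

text \<open>A crude growth bound, enough for the denominator \<open>T * F - real L\<close> below to
  be positive.\<close>

lemma fibp_ge: "n + 2 \<le> fibp (n + 4)"
proof (induction n rule: fibp.induct)
  case (3 n)
  then have "n + 2 \<le> fibp (n + 4)" "n + 3 \<le> fibp (n + 5)" by (simp_all add: eval_nat_numeral)
  then show ?case by (simp add: eval_nat_numeral)
qed (simp_all add: eval_nat_numeral)

text \<open>With K for \<open>tridiag\<close>, the ansatz is p = \<alpha> + (sum of z i * (K e) i).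
  Testing it against e_k gives \<alpha> * P + c * Z + F * z k, where Z is the sum of all z i, and
  this must equal n k. So z k is n k / F plus a number y independent of k. Testing against 1
  determines \<alpha>, and summing the z k gives Z = s + L * y; together these equations yield the
  stated \<open>y\<close>.\<close>

lemma variance_S_exact:
  fixes L N :: nat and j :: "nat set set" and n \<delta> :: "nat \<Rightarrow> real"
  defines "m \<equiv> L - 3 - of_bool (0 \<in> window j) - of_bool (5 \<in> window j)"
  defines "T \<equiv> real (fibp (L + 2)) + real (fibp L)" and "F \<equiv> real (fibp (L + 1))" and "P \<equiv> real (fibp L)"
    and "J \<equiv> real (fibp m)" and "\<Lambda> \<equiv> real (fibp m) + real (fibp (m - 2))"
    and "n \<equiv> \<lambda>i. real (site_count (window j) L i)"
  defines "\<delta> \<equiv> \<lambda>i. tridiag L n i - \<Lambda>" and "s \<equiv> (\<Sum>i<L. n i) / F"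
  defines "y \<equiv> (s - P * J) / (T * F - real L)"
  assumes L: "9 \<le> L" "odd L" and j: "j \<in> local_configs"
  shows "variance_S N L j = real N * (J / T - (J / T)\<^sup>2
    - (\<Lambda> * T - 5 * P * J) / T\<^sup>2 * (s + real L * y) - (\<Sum>i\<le>5. (n i / F + y) * (\<delta> i / T)))"
proof -
  define c where "c = real (fibp L) + real (fibp (L - 2))"
  define z where "z i = n i / F + y" for i
  define Z where "Z = s + real L * y"
  define \<alpha> where "\<alpha> = (J - 5 * P * Z) / T"
  define e :: "nat set \<Rightarrow> nat \<Rightarrow> real" where "e = (\<lambda>S i. of_bool (i \<in> S))"
  define p where "p S = \<alpha> + (\<Sum>i<L. z i * tridiag L (e S) i)" for S
  have card: "real (card (cycle_indep L)) = T" using card_cycle_indep_all[of L] L by (simp add: T_def)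
  have "L - 2 \<le> fibp (L - 4 + 4)" "1 \<le> fibp (L - 3 + 4)"
    using fibp_ge[of "L - 4"] fibp_ge[of "L - 3"] L by simp_all
  then have fibp: "L - 2 \<le> fibp L" "1 \<le> fibp (L + 1)" using L by simp_all
  have F1: "F \<ge> 1" and T: "T > real L"
    using fibp L fibp_ge[of "L - 2"] by (simp_all add: F_def T_def)
  then have pos: "F > 0" "T > 0" by simp_all
  have "T * 1 \<le> T * F" using F1 pos by (intro mult_left_mono) simp_all
  then have \<Delta>: "T * F - real L > 0" using T by linarith
  have y: "y * (T * F - real L) = s - P * J" using \<Delta> by (simp add: y_def)
  have Cas: "T * c - 5 * P\<^sup>2 = -1" using fibp_Cassini[of L] L by (simp add: T_def c_def P_def)
  \<comment> \<open>Since the determinant is -1, the factor Z = s + L * y enters with coefficient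
    -1. This is the source of both s and L in the definition of \<open>y\<close>.\<close>
  have "T * (\<alpha> * P + c * Z + F * y) = P * J + (T * c - 5 * P\<^sup>2) * Z + T * F * y"
    using pos by (simp add: \<alpha>_def field_simps power2_eq_square)
  also have "\<dots> = 0" unfolding Cas Z_def using y by (simp add: algebra_simps)
  finally have normal: "\<alpha> * P + c * Z + F * y = 0" using pos by simp
  have sumz: "(\<Sum>i<L. z i) = Z"
    by (simp add: z_def Z_def s_def sum.distrib sum_divide_distrib)
  have J: "(\<Sum>S\<in>cycle_indep L. window_ind j S) = J" using sum_window_ind L j by (simp add: J_def m_def)
  have n: "(\<Sum>S\<in>cycle_indep L. window_ind j S * e S i) = n i" if "i < L" for i
    using sum_window_ind_site[OF _ j that] L by (simp add: n_def e_def)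
  have swap: "(\<Sum>S\<in>cycle_indep L. g S * p S) = \<alpha> * (\<Sum>S\<in>cycle_indep L. g S) + (\<Sum>i<L. z i * (\<Sum>S\<in>cycle_indep L. g S * tridiag L (e S) i))" for g
  proof -
    have "(\<Sum>S\<in>cycle_indep L. g S * p S) = (\<Sum>S\<in>cycle_indep L. \<alpha> * g S + (\<Sum>i<L. z i * (g S * tridiag L (e S) i)))"
      unfolding p_def by (simp add: ring_distribs sum_distrib_left mult_ac)
    then show ?thesis
      unfolding sum.distrib sum_distrib_left sum.swap[of _ "cycle_indep L" "{..<L}"] by simp
  qed
  have "variance_S N L j = real N / real (card (cycle_indep L)) * ((\<Sum>S\<in>cycle_indep L. window_ind j S) - (\<Sum>S\<in>cycle_indep L. window_ind j S * p S))"
  \<comment> \<open>The operator is symmetric, so it can be moved from the indicators to the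
    coefficients z.\<close>
  proof (rule variance_S_eq[where \<alpha> = \<alpha> and \<beta> = "\<lambda>i. z (Suc i mod L) + 3 * z i + z (cpred L i)"])
    fix S
    have "(\<Sum>i<L. z i * e S (cpred L i)) = (\<Sum>i<L. z (Suc i mod L) * e S i)"
      using sum_cyclic_shift[of "\<lambda>i k. z k * e S i" L] by simp
    moreover have "(\<Sum>i<L. z i * e S (Suc i mod L)) = (\<Sum>i<L. z (cpred L i) * e S i)"
      using sum_cyclic_shift[of "\<lambda>i k. z i * e S k" L] by simp
    ultimately have "(\<Sum>i<L. z i * tridiag L (e S) i)
        = (\<Sum>i<L. z (Suc i mod L) * e S i) + 3 * (\<Sum>i<L. z i * e S i) + (\<Sum>i<L. z (cpred L i) * e S i)"
      by (simp only: tridiag_def ring_distribs sum.distrib sum_distrib_left mult.left_commute)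
    then show "p S = \<alpha> + (\<Sum>i<L. of_bool (i \<in> S) * (z (Suc i mod L) + 3 * z i + z (cpred L i)))"
      unfolding p_def
      by (simp only: e_def ring_distribs sum.distrib sum_distrib_left mult.left_commute mult.commute[of "of_bool _"])
  next
    have "(\<Sum>S\<in>cycle_indep L. 1 * p S) = \<alpha> * T + (\<Sum>i<L. z i * (5 * P))"
      unfolding swap using sum_cycle_indep_tridiag_one[of L] L card by (simp add: e_def P_def)
    also have "(\<Sum>i<L. z i * (5 * P)) = 5 * P * Z" unfolding sumz[symmetric] by (simp add: mult.commute flip: sum_distrib_right)
    finally have "(\<Sum>S\<in>cycle_indep L. p S) = J" using pos by (simp add: \<alpha>_def)
    then show "(\<Sum>S\<in>cycle_indep L. window_ind j S - p S) = 0" using J by (simp add: sum_subtractf)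
  next
    fix k assume k: "k < L"
    have "(\<Sum>S\<in>cycle_indep L. e S k * p S) = \<alpha> * P + (\<Sum>i<L. z i * (c + (if i = k then F else 0)))"
      unfolding swap using sum_cycle_indep_tridiag_site[OF _ _ k] sum_cycle_indep_site[OF _ k] L
      by (simp add: e_def P_def c_def F_def cong: if_cong)
    also have "(\<Sum>i<L. z i * (c + (if i = k then F else 0))) = (\<Sum>i<L. c * z i) + (\<Sum>i<L. if i = k then z i * F else 0)"
      unfolding sum.distrib[symmetric] by (rule sum.cong) (auto simp: algebra_simps)
    also have "\<dots> = c * Z + z k * F" using k by (simp add: sumz flip: sum_distrib_left)
    also have "z k * F = n k + F * y" using pos by (simp add: z_def field_simps)
    also have "\<alpha> * P + (c * Z + (n k + F * y)) = n k" using normal by simp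
    finally have "(\<Sum>S\<in>cycle_indep L. e S k * p S) = n k" .
    then show "(\<Sum>S\<in>cycle_indep L. of_bool (k \<in> S) * (window_ind j S - p S)) = 0"
      using n[OF k] by (simp only: e_def right_diff_distrib sum_subtractf mult.commute[of "of_bool _" "window_ind _ _"])
  qed (use L j in auto)
  also have "(\<Sum>S\<in>cycle_indep L. window_ind j S * p S) = \<alpha> * J + (\<Sum>i<L. z i * tridiag L n i)"
  proof -
    have "(\<Sum>S\<in>cycle_indep L. window_ind j S * tridiag L (e S) i) = tridiag L n i" if "i < L" for i
      unfolding e_def sum_cycle_indep_tridiag using n that by (intro tridiag_cong) (simp_all add: e_def)
    then show ?thesis unfolding swap J by simp
  qed
  also have "(\<Sum>i<L. z i * tridiag L n i) = \<Lambda> * Z + (\<Sum>i<L. z i * \<delta> i)"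
    unfolding sumz[symmetric] sum_distrib_left sum.distrib[symmetric]
    by (rule sum.cong) (simp_all add: \<delta>_def algebra_simps)
  also have "(\<Sum>i<L. z i * \<delta> i) = (\<Sum>i\<le>5. z i * \<delta> i)"
  proof (rule sum.mono_neutral_right)
    have "\<delta> i = 0" if "6 \<le> i" "i < L" for i
      using tridiag_site_count[OF L(1) that, of "window j"] by (simp add: \<delta>_def n_def \<Lambda>_def m_def)
    then show "\<forall>i\<in>{..<L} - {..5}. z i * \<delta> i = 0" by auto
  qed (use L in auto)
  finally have "variance_S N L j = real N / T * (J - (\<alpha> * J + (\<Lambda> * Z + (\<Sum>i\<le>5. z i * \<delta> i))))"
    unfolding J card .
  also have "\<dots> = real N * (J / T - (J / T)\<^sup>2
    - (\<Lambda> * T - 5 * P * J) / T\<^sup>2 * Z - (\<Sum>i\<le>5. z i * \<delta> i) / T)"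
    using pos by (simp add: \<alpha>_def field_simps power2_eq_square)
  finally show ?thesis by (simp add: Z_def z_def sum_divide_distrib)
qed

section \<open>Limits\<close>

lemma golden_ratio_props:
  "golden_ratio > 1" "golden_ratio ^ 2 = golden_ratio + 1" "sqrt 5 = 2 * golden_ratio - 1"
  "1 / golden_ratio = golden_ratio - 1"
proof -
  have "sqrt 5 > sqrt (1::real)" by (rule real_sqrt_less_mono) simp
  then show 1: "golden_ratio > 1" by (simp add: golden_ratio_def)
  show 2: "golden_ratio ^ 2 = golden_ratio + 1"
    by (simp add: golden_ratio_def power2_eq_square field_simps)
  show "sqrt 5 = 2 * golden_ratio - 1" by (simp add: golden_ratio_def add_divide_distrib)
  show "1 / golden_ratio = golden_ratio - 1" using 1 2 by (simp add: field_simps power2_eq_square)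
qed

text \<open>Binet's formula for the Fibonacci number of index n - 1, arranged so that no negative
  exponent occurs at n = 0.\<close>

lemma fibp_closed_form:
  "sqrt 5 * real (fibp n) = golden_ratio ^ n / golden_ratio + golden_ratio * (- 1 / golden_ratio) ^ n"
proof (induction n rule: fibp.induct)
  case 1
  have "sqrt 5 = 1 / golden_ratio + golden_ratio" unfolding golden_ratio_props(3,4) by simp
  then show ?case by simp
next
  case 2
  then show ?case using golden_ratio_props(1) by simp
next
  case (3 n)
  define \<phi> where "\<phi> = golden_ratio"
  have \<phi>: "\<phi> > 1" "\<phi> ^ 2 = \<phi> + 1" using golden_ratio_props by (simp_all add: \<phi>_def)
  define \<psi> where "\<psi> = - 1 / \<phi>"
  have \<psi>: "\<psi> ^ 2 = \<psi> + 1" using \<phi> by (simp add: \<psi>_def field_simps power2_eq_square)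
  have "sqrt 5 * real (fibp (Suc (Suc n)))
      = (\<phi> ^ Suc n / \<phi> + \<phi> * \<psi> ^ Suc n) + (\<phi> ^ n / \<phi> + \<phi> * \<psi> ^ n)"
    using 3 by (simp add: ring_distribs \<phi>_def \<psi>_def)
  also have "\<dots> = \<phi> ^ n * (\<phi> + 1) / \<phi> + \<phi> * (\<psi> ^ n * (\<psi> + 1))"
    using \<phi> by (simp add: field_simps)
  also have "\<dots> = \<phi> ^ n * \<phi> ^ 2 / \<phi> + \<phi> * (\<psi> ^ n * \<psi> ^ 2)"
    by (simp only: \<phi>(2) \<psi>)
  also have "\<dots> = \<phi> ^ Suc (Suc n) / \<phi> + \<phi> * \<psi> ^ Suc (Suc n)"
    by (simp add: power2_eq_square mult_ac)
  finally show ?case by (simp only: \<phi>_def \<psi>_def)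
qed

lemma fibp_lim: "(\<lambda>n. real (fibp n) / golden_ratio ^ n) \<longlonglongrightarrow> 1 / (sqrt 5 * golden_ratio)"
proof -
  define \<phi> where "\<phi> = golden_ratio"
  have \<phi>: "\<phi> > 1" using golden_ratio_props by (simp add: \<phi>_def)
  have "real (fibp n) / \<phi> ^ n = (1 / \<phi> + \<phi> * ((- 1 / \<phi>) / \<phi>) ^ n) / sqrt 5" for n
  proof -
    have "sqrt 5 * (real (fibp n) / \<phi> ^ n) = (\<phi> ^ n / \<phi> + \<phi> * (- 1 / \<phi>) ^ n) / \<phi> ^ n"
      unfolding \<phi>_def fibp_closed_form[symmetric] by simp
    also have "\<dots> = 1 / \<phi> + \<phi> * ((- 1 / \<phi>) ^ n / \<phi> ^ n)"
      using \<phi> by (simp add: add_divide_distrib)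
    finally have "sqrt 5 * (real (fibp n) / \<phi> ^ n) = 1 / \<phi> + \<phi> * ((- 1 / \<phi>) / \<phi>) ^ n"
      by (simp only: power_divide)
    then show ?thesis by (simp add: field_simps)
  qed
  moreover have "(\<lambda>n. (1 / \<phi> + \<phi> * ((- 1 / \<phi>) / \<phi>) ^ n) / sqrt 5) \<longlonglongrightarrow> (1 / \<phi> + \<phi> * 0) / sqrt 5"
  proof (intro tendsto_intros LIMSEQ_power_zero)
    have "1 * 1 < \<phi> * \<phi>" using \<phi> by (intro mult_strict_mono) auto
    then show "norm (- 1 / \<phi> / \<phi>) < 1" using \<phi> by (simp add: field_simps abs_mult)
  qed simp
  ultimately show ?thesis by (simp add: \<phi>_def mult.commute)
qed

lemma fibp_lim_plus:
  "(\<lambda>L. real (fibp (L + k)) / golden_ratio ^ L) \<longlonglongrightarrow> golden_ratio ^ k / (sqrt 5 * golden_ratio)"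
proof -
  have "(\<lambda>L. golden_ratio ^ k * (real (fibp (L + k)) / golden_ratio ^ (L + k)))
      \<longlonglongrightarrow> golden_ratio ^ k * (1 / (sqrt 5 * golden_ratio))"
    by (intro tendsto_mult tendsto_const LIMSEQ_ignore_initial_segment[OF fibp_lim])
  then show ?thesis using golden_ratio_props(1) by (simp add: power_add)
qed

lemma fibp_lim_minus:
  "(\<lambda>L. real (fibp (L - k)) / golden_ratio ^ L) \<longlonglongrightarrow> 1 / (sqrt 5 * golden_ratio ^ Suc k)"
\<comment> \<open>Shifting the index by k removes the truncated subtraction.\<close>
proof (rule LIMSEQ_offset[of _ k])
  have "(\<lambda>L. (real (fibp L) / golden_ratio ^ L) / golden_ratio ^ k) \<longlonglongrightarrow> (1 / (sqrt 5 * golden_ratio)) / golden_ratio ^ k"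
    by (intro tendsto_divide fibp_lim tendsto_const) (use golden_ratio_props(1) in simp)
  then show "(\<lambda>L. real (fibp (L + k - k)) / golden_ratio ^ (L + k)) \<longlonglongrightarrow> 1 / (sqrt 5 * golden_ratio ^ Suc k)"
    by (simp add: power_add mult_ac)
qed

lemma linear_over_golden_power: "(\<lambda>L. real L / golden_ratio ^ L) \<longlonglongrightarrow> 0"
proof -
  have "norm (1 / golden_ratio) < 1" using golden_ratio_props(1) by simp
  from powser_times_n_limit_0[OF this] show ?thesis by (simp add: power_one_over field_simps)
qed

text \<open>With \<open>g = 1 / \<phi>\<close> one has \<open>g\<^sup>2 = 1 - g\<close>, \<open>\<phi> = 1 + g\<close> and \<open>\<surd>5 = 1 + 2 g\<close>, so the claim is a
  polynomial identity in \<open>g\<close>.\<close>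

lemma window_sum_identity:
  fixes W :: "nat set" and g :: real
  defines "x \<equiv> \<lambda>i. of_bool (i \<in> W)"
  defines "d \<equiv> \<lambda>i. (if i = 0 then (1 - x 0) * g\<^sup>2 else x (i - 1)) + 3 * x i
     + (if i = 5 then (1 - x 5) * g\<^sup>2 else x (i + 1)) - (1 + g\<^sup>2)"
  assumes W: "\<And>i. i < 5 \<Longrightarrow> \<not> (i \<in> W \<and> Suc i \<in> W)" and g: "g\<^sup>2 = 1 - g"
  shows "(2 + g) * (1 + (\<Sum>i\<le>5. ((1 + 2 * g) * x i - g) * d i))
     = (1 + 2 * g) * (x 0 + x 5 + g * (\<Sum>i\<le>5. x i) + (6 + g))"
proof -
  have sum: "(\<Sum>i\<le>5. f i) = f 0 + f 1 + f 2 + f 3 + f 4 + f 5" for f :: "nat \<Rightarrow> real"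
    by (simp add: eval_nat_numeral)
  have sq: "x i * x i = x i" for i by (simp add: x_def)
  have adj: "x i * x (Suc i) = 0" if "i < 5" for i using W[OF that] by (simp add: x_def)
  \<comment> \<open>Neighbours exclude each other and (1 - x i) * x i = 0, so multiplication by x i
    leaves of d i only the diagonal 3 and the constant 1 + g^2.\<close>
  have "(\<Sum>i\<le>5. x i * d i) = (\<Sum>i\<le>5. (2 - g\<^sup>2) * x i)"
  proof (rule sum.cong)
    fix i :: nat assume "i \<in> {..5}"
    then show "x i * d i = (2 - g\<^sup>2) * x i"
      using sq[of i] adj[of i] adj[of "i - 1"]
      by (auto simp: d_def algebra_simps)
  qed simp
  \<comment> \<open>Each x i is counted with total weight 1 + 3 + 1, except that the two end indices
    lack one neighbour.\<close>
  moreover have "(\<Sum>i\<le>5. d i) = 5 * (\<Sum>i\<le>5. x i) - (x 0 + x 5) + (2 - (x 0 + x 5)) * g\<^sup>2 - 6 * (1 + g\<^sup>2)"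
    unfolding sum d_def by (simp add: algebra_simps eval_nat_numeral)
  moreover have "(\<Sum>i\<le>5. ((1 + 2 * g) * x i - g) * d i) = (1 + 2 * g) * (\<Sum>i\<le>5. x i * d i) - g * (\<Sum>i\<le>5. d i)"
    by (simp add: sum_distrib_left sum_subtractf algebra_simps)
  ultimately have *: "(\<Sum>i\<le>5. ((1 + 2 * g) * x i - g) * d i)
    = (1 + 2 * g) * ((2 - g\<^sup>2) * (\<Sum>i\<le>5. x i)) - g * (5 * (\<Sum>i\<le>5. x i) - (x 0 + x 5)
      + (2 - (x 0 + x 5)) * g\<^sup>2 - 6 * (1 + g\<^sup>2))"
    by (simp add: sum_distrib_left)
  define f \<epsilon> where "f = (\<Sum>i\<le>5. x i)" and "\<epsilon> = x 0 + x 5"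
  have gg: "g * g = 1 - g" using g by (simp add: power2_eq_square)
  have ggr: "g * (g * r) = r - g * r" for r
    using gg by (simp add: left_diff_distrib flip: mult.assoc)
  show ?thesis
    unfolding * unfolding f_def[symmetric] \<epsilon>_def[symmetric] g
    by (simp add: algebra_simps gg ggr)
qed

text \<open>The number of tiles is asymptotic to \<phi>^L, so these are limiting probabilities, and
  \<open>\<pi>\<close> is that of the local configuration. An edge next to the window is excluded if
  the window end is chosen; otherwise its presence costs a factor \<phi>^(-2).\<close>

lemma site_count_lim:
  fixes W :: "nat set"
  defines "\<pi> \<equiv> 1 / (sqrt 5 * golden_ratio ^ (4 + of_bool (0 \<in> W) + of_bool (5 \<in> W)))"
  shows "i \<le> 5 \<Longrightarrow> (\<lambda>L. real (site_count W L i) / golden_ratio ^ L) \<longlonglongrightarrow> \<pi> * of_bool (i \<in> W)"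
    and "(\<lambda>L. real (site_count W L 6) / golden_ratio ^ L) \<longlonglongrightarrow> \<pi> * ((1 - of_bool (5 \<in> W)) * (1 / golden_ratio)\<^sup>2)"
    and "(\<lambda>L. real (site_count W L (L - 1)) / golden_ratio ^ L) \<longlonglongrightarrow> \<pi> * ((1 - of_bool (0 \<in> W)) * (1 / golden_ratio)\<^sup>2)"
proof -
  have m: "(\<lambda>L. real (fibp (L - 3 - of_bool (0 \<in> W) - of_bool (5 \<in> W))) / golden_ratio ^ L) \<longlonglongrightarrow> \<pi>"
    using fibp_lim_minus[of "3 + of_bool (0 \<in> W) + of_bool (5 \<in> W)"]
    by (cases "0 \<in> W"; cases "5 \<in> W") (simp_all add: \<pi>_def)
  show "(\<lambda>L. real (site_count W L i) / golden_ratio ^ L) \<longlonglongrightarrow> \<pi> * of_bool (i \<in> W)" if "i \<le> 5"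
    using m that by (cases "i \<in> W") (simp_all add: site_count_def)
  have six: "\<forall>\<^sub>F L in sequentially. real (site_count W L 6) / golden_ratio ^ L
      = (1 - of_bool (5 \<in> W)) * (real (fibp (L - (5 + of_bool (0 \<in> W)))) / golden_ratio ^ L)"
    using eventually_ge_at_top[of 9]
  proof eventually_elim
    case (elim L)
    have "L - 6 + 1 - of_bool (0 \<in> W) = L - (5 + of_bool (0 \<in> W))" "fibp (6 - 4 - of_bool (5 \<in> W)) = 1 - of_bool (5 \<in> W)"
      using elim by (cases "0 \<in> W"; cases "5 \<in> W"; simp add: eval_nat_numeral)+
    then show ?case by (simp add: site_count_def)
  qed
  have "(\<lambda>L. (1 - of_bool (5 \<in> W)) * (real (fibp (L - (5 + of_bool (0 \<in> W)))) / golden_ratio ^ L))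
      \<longlonglongrightarrow> (1 - of_bool (5 \<in> W)) * (1 / (sqrt 5 * golden_ratio ^ Suc (5 + of_bool (0 \<in> W))))"
    by (intro tendsto_mult tendsto_const fibp_lim_minus)
  also have "(1 - of_bool (5 \<in> W)) * (1 / (sqrt 5 * golden_ratio ^ Suc (5 + of_bool (0 \<in> W))))
      = \<pi> * ((1 - of_bool (5 \<in> W)) * (1 / golden_ratio)\<^sup>2)"
    by (cases "0 \<in> W"; cases "5 \<in> W") (simp_all add: \<pi>_def eval_nat_numeral)
  finally show "(\<lambda>L. real (site_count W L 6) / golden_ratio ^ L) \<longlonglongrightarrow> \<pi> * ((1 - of_bool (5 \<in> W)) * (1 / golden_ratio)\<^sup>2)"
    by (subst tendsto_cong[OF six])
  have last: "\<forall>\<^sub>F L in sequentially. real (site_count W L (L - 1)) / golden_ratio ^ L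
      = (1 - of_bool (0 \<in> W)) * (real (fibp (L - (5 + of_bool (5 \<in> W)))) / golden_ratio ^ L)"
    using eventually_ge_at_top[of 9]
  proof eventually_elim
    case (elim L)
    have "L - 1 - 4 - of_bool (5 \<in> W) = L - (5 + of_bool (5 \<in> W))"
      "fibp (L - (L - 1) + 1 - of_bool (0 \<in> W)) = 1 - of_bool (0 \<in> W)" "\<not> L - 1 \<le> 5"
      using elim by (cases "0 \<in> W"; cases "5 \<in> W"; simp add: eval_nat_numeral)+
    then show ?case by (simp only: site_count_def if_False of_nat_mult) simp
  qed
  have "(\<lambda>L. (1 - of_bool (0 \<in> W)) * (real (fibp (L - (5 + of_bool (5 \<in> W)))) / golden_ratio ^ L))
      \<longlonglongrightarrow> (1 - of_bool (0 \<in> W)) * (1 / (sqrt 5 * golden_ratio ^ Suc (5 + of_bool (5 \<in> W))))"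
    by (intro tendsto_mult tendsto_const fibp_lim_minus)
  also have "(1 - of_bool (0 \<in> W)) * (1 / (sqrt 5 * golden_ratio ^ Suc (5 + of_bool (5 \<in> W))))
      = \<pi> * ((1 - of_bool (0 \<in> W)) * (1 / golden_ratio)\<^sup>2)"
    by (cases "0 \<in> W"; cases "5 \<in> W") (simp_all add: \<pi>_def eval_nat_numeral)
  finally show "(\<lambda>L. real (site_count W L (L - 1)) / golden_ratio ^ L) \<longlonglongrightarrow> \<pi> * ((1 - of_bool (0 \<in> W)) * (1 / golden_ratio)\<^sup>2)"
    by (subst tendsto_cong[OF last])
qed

lemma site_count_le:
  assumes "7 \<le> L" "j \<in> local_configs" "i < L"
  shows "real (site_count (window j) L i)
    \<le> real (fibp (L - 3 - of_bool (0 \<in> window j) - of_bool (5 \<in> window j)))"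
  unfolding sum_window_ind_site[OF assms, symmetric] sum_window_ind[OF assms(1,2), symmetric]
  by (rule sum_mono) (simp add: window_ind_def)

text \<open>Everything is measured in units of \<phi>^L. Relative to \<open>\<pi>\<close>, the
  coefficient z i tends to \<open>sqrt 5 * x i - g\<close> and the defect \<delta> i to
  \<open>d i\<close>. The exact expression \<open>V\<close> converges along all L; restriction to
  odd L serves to identify it with the variance.\<close>

lemma expectation_variance_lim:
  fixes N :: nat and j :: "nat set set"
  assumes j: "j \<in> local_configs"
  defines "g \<equiv> 1 / golden_ratio" and "x \<equiv> \<lambda>i. of_bool (i \<in> window j) :: real"
  defines "\<pi> \<equiv> 1 / (sqrt 5 * golden_ratio ^ (4 + num_endmost j))"
  defines "d \<equiv> \<lambda>i. (if i = 0 then (1 - x 0) * g\<^sup>2 else x (i - 1)) + 3 * x i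
     + (if i = 5 then (1 - x 5) * g\<^sup>2 else x (i + 1)) - (1 + g\<^sup>2)"
  defines "Fl \<equiv> inf sequentially (principal {L. odd L \<and> L \<ge> 7})"
  shows "((\<lambda>L. expectation_S N L j) \<longlongrightarrow> real N * \<pi>) Fl"
    and "((\<lambda>L. variance_S N L j) \<longlongrightarrow> real N * (\<pi> - \<pi>\<^sup>2 - \<pi>\<^sup>2 * (\<Sum>i\<le>5. (sqrt 5 * x i - g) * d i))) Fl"
proof -
  define k where "k = 3 + of_bool (0 \<in> window j) + (of_bool (5 \<in> window j) :: nat)"
  have num: "num_endmost j + 3 = k" using num_endmost_window[OF j] by (simp add: k_def)
  define \<phi> where "\<phi> = golden_ratio"
  have \<phi>: "\<phi> > 1" "\<phi> ^ 2 = \<phi> + 1" "sqrt 5 = 2 * \<phi> - 1" "g = 1 / \<phi>"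
    using golden_ratio_props by (simp_all add: \<phi>_def g_def)
  define u where "u L = \<phi> ^ L" for L :: nat
  have u: "u L > 0" "u L \<ge> 1" for L using \<phi>(1) by (simp_all add: u_def one_le_power)
  have m: "L - 3 - of_bool (0 \<in> window j) - of_bool (5 \<in> window j) = L - k" for L
    by (simp add: k_def)
  define T F P J \<Lambda> where "T L = real (fibp (L + 2)) + real (fibp L)" and "F L = real (fibp (L + 1))"
    and "P L = real (fibp L)" and "J L = real (fibp (L - k))" and "\<Lambda> L = real (fibp (L - k)) + real (fibp (L - k - 2))"
    for L :: nat
  define n where "n L i = real (site_count (window j) L i)" for L i
  define s where "s L = (\<Sum>i<L. n L i) / F L" for L
  define y where "y L = (s L - P L * J L) / (T L * F L - real L)" for L
  define \<delta> where "\<delta> L i = tridiag L (n L) i - \<Lambda> L" for L i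
  define V where "V L = real N * (J L / T L - (J L / T L)\<^sup>2
    - (\<Lambda> L * T L - 5 * P L * J L) / (T L)\<^sup>2 * (s L + real L * y L)
    - (\<Sum>i\<le>5. (n L i / F L + y L) * (\<delta> L i / T L)))" for L
  have T1: "(\<phi> ^ 2 + \<phi> ^ 0) / (sqrt 5 * \<phi>) = 1"
  proof -
    have "sqrt 5 * \<phi> = 2 * \<phi> ^ 2 - \<phi>" unfolding \<phi>(3) by (simp add: power2_eq_square algebra_simps)
    then have "sqrt 5 * \<phi> = \<phi> ^ 2 + \<phi> ^ 0" unfolding \<phi>(2) by simp
    moreover have "sqrt 5 * \<phi> \<noteq> 0" using \<phi>(1) by simp
    ultimately show ?thesis by (metis divide_self)
  qed
  have limT: "(\<lambda>L. T L / u L) \<longlonglongrightarrow> 1"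
    using tendsto_add[OF fibp_lim_plus[of 2] fibp_lim_plus[of 0]] T1
    by (simp add: T_def u_def \<phi>_def add_divide_distrib)
  have limF: "(\<lambda>L. F L / u L) \<longlonglongrightarrow> 1 / sqrt 5"
    using fibp_lim_plus[of 1] \<phi>(1) by (simp add: F_def u_def \<phi>_def)
  have limP: "(\<lambda>L. P L / u L) \<longlonglongrightarrow> g / sqrt 5"
    using fibp_lim \<phi>(1) by (simp add: P_def u_def \<phi>_def g_def mult.commute)
  have limJ: "(\<lambda>L. J L / u L) \<longlonglongrightarrow> \<pi>"
    using fibp_lim_minus[of k] by (simp add: J_def u_def \<phi>_def \<pi>_def flip: num)
  have "golden_ratio ^ Suc (k + 2) = golden_ratio ^ (4 + num_endmost j) * golden_ratio\<^sup>2"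
    unfolding power_add[symmetric] num[symmetric] by (rule arg_cong) simp
  then have "1 / (sqrt 5 * golden_ratio ^ Suc (k + 2)) = \<pi> * g\<^sup>2"
    by (simp only: \<pi>_def g_def power_divide) simp
  then have lim\<Lambda>: "(\<lambda>L. \<Lambda> L / u L) \<longlonglongrightarrow> \<pi> * (1 + g\<^sup>2)"
    using tendsto_add[OF limJ fibp_lim_minus[of "k + 2"]]
    by (simp add: \<Lambda>_def J_def u_def \<phi>_def add_divide_distrib ring_distribs)
  have limL: "(\<lambda>L. real L / u L) \<longlonglongrightarrow> 0"
    using linear_over_golden_power by (simp add: u_def \<phi>_def)
  have limu: "(\<lambda>L. 1 / u L) \<longlonglongrightarrow> 0"
    using LIMSEQ_power_zero[of "1 / \<phi>"] \<phi>(1) by (simp add: u_def power_one_over)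
  have limJT: "(\<lambda>L. J L / T L) \<longlonglongrightarrow> \<pi>"
  proof -
    have "(\<lambda>L. (J L / u L) / (T L / u L)) \<longlonglongrightarrow> \<pi> / 1" by (intro tendsto_divide limJ limT) simp
    then show ?thesis using u(1) by (simp add: less_imp_neq[symmetric])
  qed
  have s_bounds: "0 \<le> s L \<and> s L \<le> real L * J L / F L" if "7 \<le> L" for L
  proof -
    have "(\<Sum>i<L. n L i) \<le> (\<Sum>i<L. J L)"
      using site_count_le[OF that j] unfolding m by (intro sum_mono) (simp add: n_def J_def)
    moreover have "0 \<le> (\<Sum>i<L. n L i)" by (intro sum_nonneg) (simp add: n_def)
    ultimately show ?thesis by (simp add: s_def F_def divide_right_mono)
  qed
  \<comment> \<open>A sum of L terms, each at most J / F, grows at most linearly.\<close>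
  have lims: "(\<lambda>L. s L / u L) \<longlonglongrightarrow> 0"
  proof (rule real_tendsto_sandwich[where f = "\<lambda>_. 0"
        and h = "\<lambda>L. (real L / u L) * (J L / u L) / (F L / u L)"])
    have "(\<lambda>L. (real L / u L) * (J L / u L) / (F L / u L)) \<longlonglongrightarrow> 0 * \<pi> / (1 / sqrt 5)"
      by (intro tendsto_intros limL limJ limF) simp
    then show "(\<lambda>L. (real L / u L) * (J L / u L) / (F L / u L)) \<longlonglongrightarrow> 0" by simp
    show "\<forall>\<^sub>F L in sequentially. s L / u L \<le> (real L / u L) * (J L / u L) / (F L / u L)"
      using eventually_ge_at_top[of 7]
    proof eventually_elim
      case (elim L)
      have "s L / u L \<le> (real L * J L / F L) / u L"
        using s_bounds[OF elim] u(1)[of L] by (intro divide_right_mono) auto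
      also have "\<dots> = (real L / u L) * (J L / u L) / (F L / u L)"
        using u(1)[of L] by (simp add: field_simps)
      finally show ?case .
    qed
    show "\<forall>\<^sub>F L in sequentially. 0 \<le> s L / u L"
      using eventually_ge_at_top[of 7] by eventually_elim (use s_bounds u(1) in \<open>simp add: less_imp_le\<close>)
  qed simp
  \<comment> \<open>In units of u^2 both s and L are negligible, so only -P * J / (T * F)
    contributes.\<close>
  have limy: "y \<longlonglongrightarrow> - \<pi> * g"
  proof -
    have "(\<lambda>L. ((s L / u L) * (1 / u L) - (P L / u L) * (J L / u L)) / ((T L / u L) * (F L / u L) - (real L / u L) * (1 / u L)))
        \<longlonglongrightarrow> (0 * 0 - (g / sqrt 5) * \<pi>) / (1 * (1 / sqrt 5) - 0 * 0)"
      by (intro tendsto_intros lims limu limP limJ limT limF limL) simp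
    moreover have "((s L / u L) * (1 / u L) - (P L / u L) * (J L / u L)) / ((T L / u L) * (F L / u L) - (real L / u L) * (1 / u L)) = y L" for L
    proof -
      have "(s L / u L) * (1 / u L) - (P L / u L) * (J L / u L) = (s L - P L * J L) / (u L * u L)"
        "(T L / u L) * (F L / u L) - (real L / u L) * (1 / u L) = (T L * F L - real L) / (u L * u L)"
        by (simp_all add: diff_divide_distrib)
      then show ?thesis using u(1)[of L] by (simp add: y_def)
    qed
    ultimately show ?thesis by (simp add: mult.commute[of g \<pi>])
  qed
  \<comment> \<open>By \<open>fibp_conserved\<close> the numerator has the constant absolute value
    of \<open>X 2\<close>. This leaves (s + L * y) / T^2, in which a single factor 1 / u already
    absorbs the linear growth.\<close>
  have lim_remainder: "(\<lambda>L. (\<Lambda> L * T L - 5 * P L * J L) / (T L)\<^sup>2 * (s L + real L * y L)) \<longlonglongrightarrow> 0"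
  proof (rule tendsto_0_le)
    have "(\<lambda>L. (1 / u L) * ((s L / u L) + (real L / u L) * y L) / (T L / u L)\<^sup>2) \<longlonglongrightarrow> 0 * (0 + 0 * (- \<pi> * g)) / 1\<^sup>2"
      by (intro tendsto_intros limu lims limL limy limT) simp
    then show "(\<lambda>L. (1 / u L) * ((s L / u L) + (real L / u L) * y L) / (T L / u L)\<^sup>2) \<longlonglongrightarrow> 0" by simp
    define X where "X m = (real (fibp m) + real (fibp (m - 2))) * (real (fibp (m + k + 2)) + real (fibp (m + k)))
      - 5 * real (fibp (m + k)) * real (fibp m)" for m
    show "\<forall>\<^sub>F L in sequentially. norm ((\<Lambda> L * T L - 5 * P L * J L) / (T L)\<^sup>2 * (s L + real L * y L))
      \<le> norm ((1 / u L) * ((s L / u L) + (real L / u L) * y L) / (T L / u L)\<^sup>2) * \<bar>X 2\<bar>"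
      using eventually_ge_at_top[of "k + 2"]
    proof eventually_elim
      case (elim L)
      define r where "r = L - k - 2"
      have L: "L - k = r + 2" "r + 2 + k = L" using elim by (simp_all add: r_def)
      have "\<Lambda> L * T L - 5 * P L * J L = X (r + 2)"
        unfolding \<Lambda>_def T_def P_def J_def X_def L by simp
      also have "\<dots> = (-1) ^ r * X 2" unfolding X_def by (rule fibp_conserved)
      finally have "\<bar>\<Lambda> L * T L - 5 * P L * J L\<bar> = \<bar>X 2\<bar>" by (simp add: abs_mult)
      moreover have "(1 / u L) * ((s L / u L) + (real L / u L) * y L) / (T L / u L)\<^sup>2 = (s L + real L * y L) / (T L)\<^sup>2"
      proof -
        have "(1 / u L) * ((s L / u L) + (real L / u L) * y L) = (s L + real L * y L) / (u L * u L)"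
          "(T L / u L)\<^sup>2 = (T L)\<^sup>2 / (u L * u L)"
          by (simp_all add: add_divide_distrib power_divide power2_eq_square)
        then show ?thesis using u(1)[of L] by simp
      qed
      ultimately show ?case by (simp add: abs_mult mult.commute)
    qed
  qed
  have \<pi>: "\<pi> = 1 / (sqrt 5 * golden_ratio ^ (4 + of_bool (0 \<in> window j) + of_bool (5 \<in> window j)))"
    unfolding \<pi>_def num_endmost_window[OF j] by (simp add: add.assoc)
  have limn: "(\<lambda>L. n L i / u L) \<longlonglongrightarrow> \<pi> * x i" if "i \<le> 5" for i
    using site_count_lim(1)[OF that, of "window j"] by (simp add: n_def u_def x_def \<phi>_def \<pi>)
  have limpred: "(\<lambda>L. n L (cpred L i) / u L) \<longlonglongrightarrow> \<pi> * (if i = 0 then (1 - x 0) * g\<^sup>2 else x (i - 1))" if "i \<le> 5" for i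
    using limn[of "i - 1"] that site_count_lim(3)[of "window j"]
    by (cases "i = 0") (simp_all add: cpred_def n_def u_def x_def \<phi>_def \<pi> g_def)
  have limsuc: "(\<lambda>L. n L (Suc i mod L) / u L) \<longlonglongrightarrow> \<pi> * (if i = 5 then (1 - x 5) * g\<^sup>2 else x (i + 1))" if "i \<le> 5" for i
  proof -
    have "(\<lambda>L. n L (Suc i) / u L) \<longlonglongrightarrow> \<pi> * (if i = 5 then (1 - x 5) * g\<^sup>2 else x (i + 1))"
      using limn[of "Suc i"] that site_count_lim(2)[of "window j"]
      by (cases "i = 5") (simp_all add: n_def u_def x_def \<phi>_def \<pi> g_def)
    moreover have "\<forall>\<^sub>F L in sequentially. n L (Suc i mod L) / u L = n L (Suc i) / u L"
      using eventually_ge_at_top[of 7] by eventually_elim (use that in simp)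
    ultimately show ?thesis by (subst tendsto_cong)
  qed
  have lim\<delta>: "(\<lambda>L. \<delta> L i / u L) \<longlonglongrightarrow> \<pi> * d i" if "i \<le> 5" for i
  proof -
    have "(\<lambda>L. n L (cpred L i) / u L + 3 * (n L i / u L) + n L (Suc i mod L) / u L - \<Lambda> L / u L)
      \<longlonglongrightarrow> \<pi> * (if i = 0 then (1 - x 0) * g\<^sup>2 else x (i - 1)) + 3 * (\<pi> * x i)
        + \<pi> * (if i = 5 then (1 - x 5) * g\<^sup>2 else x (i + 1)) - \<pi> * (1 + g\<^sup>2)"
      by (intro tendsto_add tendsto_diff tendsto_mult tendsto_const limpred limn limsuc lim\<Lambda> that)
    then show ?thesis
      by (simp add: \<delta>_def tridiag_def d_def add_divide_distrib diff_divide_distrib ring_distribs mult.left_commute)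
  qed
  have lim\<delta>T: "(\<lambda>L. \<delta> L i / T L) \<longlonglongrightarrow> \<pi> * d i" if "i \<le> 5" for i
  proof -
    have "(\<lambda>L. (\<delta> L i / u L) / (T L / u L)) \<longlonglongrightarrow> \<pi> * d i / 1"
      by (intro tendsto_divide lim\<delta> limT that) simp
    then show ?thesis using u(1) by (simp add: less_imp_neq[symmetric])
  qed
  have limnF: "(\<lambda>L. n L i / F L) \<longlonglongrightarrow> \<pi> * (sqrt 5 * x i)" if "i \<le> 5" for i
  proof -
    have "(\<lambda>L. (n L i / u L) / (F L / u L)) \<longlonglongrightarrow> \<pi> * x i / (1 / sqrt 5)"
      by (intro tendsto_divide limn limF that) simp
    then show ?thesis using u(1) by (simp add: less_imp_neq[symmetric] mult_ac)
  qed
  have "V \<longlonglongrightarrow> real N * (\<pi> - \<pi>\<^sup>2 - 0 - (\<Sum>i\<le>5. (\<pi> * (sqrt 5 * x i) + - \<pi> * g) * (\<pi> * d i)))"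
    unfolding V_def
    by (intro tendsto_intros limJT lim_remainder limy limnF lim\<delta>T) simp_all
  also have "(\<Sum>i\<le>5. (\<pi> * (sqrt 5 * x i) + - \<pi> * g) * (\<pi> * d i)) = \<pi>\<^sup>2 * (\<Sum>i\<le>5. (sqrt 5 * x i - g) * d i)"
    unfolding sum_distrib_left by (rule sum.cong) (simp_all add: power2_eq_square algebra_simps)
  finally have "(V \<longlongrightarrow> real N * (\<pi> - \<pi>\<^sup>2 - \<pi>\<^sup>2 * (\<Sum>i\<le>5. (sqrt 5 * x i - g) * d i))) Fl"
    unfolding Fl_def by (intro tendsto_mono[OF inf_le1]) simp
  moreover have "\<forall>\<^sub>F L in Fl. variance_S N L j = V L"
    unfolding Fl_def eventually_inf_principal
    using eventually_ge_at_top[of 9]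
  proof eventually_elim
    case (elim L)
    show ?case
    proof
      assume "L \<in> {L. odd L \<and> 7 \<le> L}"
      then have "odd L" by simp
      then show "variance_S N L j = V L"
        using variance_S_exact[OF elim _ j, of N]
        unfolding m by (simp only: V_def T_def F_def P_def J_def \<Lambda>_def n_def[abs_def] s_def y_def \<delta>_def
          not_False_eq_True)
    qed
  qed
  ultimately show "((\<lambda>L. variance_S N L j) \<longlongrightarrow> real N * (\<pi> - \<pi>\<^sup>2 - \<pi>\<^sup>2 * (\<Sum>i\<le>5. (sqrt 5 * x i - g) * d i))) Fl"
    by (subst tendsto_cong)
  have "((\<lambda>L. real N * (J L / T L)) \<longlongrightarrow> real N * \<pi>) Fl"
    unfolding Fl_def by (intro tendsto_mono[OF inf_le1] tendsto_mult tendsto_const limJT)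
  moreover have "\<forall>\<^sub>F L in Fl. expectation_S N L j = real N * (J L / T L)"
    unfolding Fl_def eventually_inf_principal
    using eventually_ge_at_top[of 9]
  proof eventually_elim
    case (elim L)
    then show ?case
      using expectation_S_eq[OF _ j, of L N] sum_window_ind[OF _ j, of L] card_cycle_indep_all[of L]
      unfolding m by (simp add: J_def T_def)
  qed
  ultimately show "((\<lambda>L. expectation_S N L j) \<longlongrightarrow> real N * \<pi>) Fl"
    by (subst tendsto_cong)
qed

theorem mainTheorem3:
  fixes N :: nat and j :: "nat set set"
  assumes "N \<ge> 1" and "j \<in> local_configs"
  shows "((\<lambda>L. expectation_S N L j) \<longlongrightarrow>
           real N * golden_ratio powi (- int (num_endmost j) - 4) / sqrt 5)
           (inf sequentially (principal {L. odd L \<and> L \<ge> 7}))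
       \<and> ((\<lambda>L. variance_S N L j) \<longlongrightarrow>
           real N * golden_ratio powi (- int (num_endmost j) - 4) / sqrt 5
             * (1 - (real (num_endmost j) + golden_ratio powi (- 1) * real (card j)
                       + (11 + sqrt 5) / 2)
                    / golden_ratio ^ (num_endmost j + 6)))
           (inf sequentially (principal {L. odd L \<and> L \<ge> 7}))"
proof -
  define g x \<pi> where "g = 1 / golden_ratio" and "x i = (of_bool (i \<in> window j) :: real)"
    and "\<pi> = 1 / (sqrt 5 * golden_ratio ^ (4 + num_endmost j))" for i
  define d where "d i = (if i = 0 then (1 - x 0) * g\<^sup>2 else x (i - 1)) + 3 * x i
     + (if i = 5 then (1 - x 5) * g\<^sup>2 else x (i + 1)) - (1 + g\<^sup>2)" for i
  have g1: "g = golden_ratio - 1" using golden_ratio_props(4) by (simp add: g_def)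
  have g: "g = golden_ratio - 1" "g\<^sup>2 = 1 - g" "sqrt 5 = 1 + 2 * g" "golden_ratio\<^sup>2 = 2 + g" "golden_ratio > 1"
    using golden_ratio_props(1-3) unfolding g1 by (simp_all add: power2_eq_square algebra_simps)
  have \<pi>: "golden_ratio powi (- int (num_endmost j) - 4) / sqrt 5 = \<pi>"
  proof -
    have "- int (num_endmost j) - 4 = - int (4 + num_endmost j)" by simp
    then show ?thesis
      by (simp only: power_int_minus power_int_of_nat) (simp add: \<pi>_def field_simps)
  qed
  have W: "\<not> (i \<in> window j \<and> Suc i \<in> window j)" if "i < 5" for i
    using window_in_path_indep[OF assms(2)] that by (simp add: path_indep_def)
  have f: "real (card j) = (\<Sum>i\<le>5. x i)"
  proof -
    have "window j \<subseteq> {..<6}" by (auto simp: window_def)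
    then have "real (card (window j)) = (\<Sum>i<6. x i)" unfolding x_def by (rule card_eq_sum_of_bool)
    moreover have "{..<6::nat} = {..5}" by auto
    ultimately show ?thesis using card_window[OF assms(2)] by simp
  qed
  have \<epsilon>: "real (num_endmost j) = x 0 + x 5"
    using num_endmost_window[OF assms(2)] by (simp add: x_def)
  have 1: "(2 + g) * (1 + (\<Sum>i\<le>5. (sqrt 5 * x i - g) * d i))
     = sqrt 5 * (real (num_endmost j) + g * real (card j) + (6 + g))"
    unfolding \<epsilon> f g(3) d_def x_def by (rule window_sum_identity[OF W g(2)])
  \<comment> \<open>The constant in the variance is 6 + 1 / \<phi> in disguise.\<close>
  have 2: "(11 + sqrt 5) / 2 = 6 + g" unfolding g(3) by simp
  have "1 + (\<Sum>i\<le>5. (sqrt 5 * x i - g) * d i)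
     = sqrt 5 * (real (num_endmost j) + g * real (card j) + (11 + sqrt 5) / 2) / golden_ratio\<^sup>2"
  proof (rule eq_divide_imp)
    show "(1 + (\<Sum>i\<le>5. (sqrt 5 * x i - g) * d i)) * golden_ratio\<^sup>2
       = sqrt 5 * (real (num_endmost j) + g * real (card j) + (11 + sqrt 5) / 2)"
      using 1 unfolding 2 g(4) by (simp only: mult.commute)
  qed (use g(5) in simp)
  \<comment> \<open>The factor \<open>sqrt 5\<close> cancels against the one in
    \<open>\<pi>\<close>, and \<phi>^2 raises the exponent from 4 + \<epsilon> to 6 +
    \<epsilon>.\<close>
  then have "\<pi> * (1 + (\<Sum>i\<le>5. (sqrt 5 * x i - g) * d i))
     = (real (num_endmost j) + g * real (card j) + (11 + sqrt 5) / 2) / golden_ratio ^ (num_endmost j + 6)"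
    using g(5) by (simp add: \<pi>_def power_add eval_nat_numeral)
  moreover have "\<pi> - \<pi>\<^sup>2 - \<pi>\<^sup>2 * (\<Sum>i\<le>5. (sqrt 5 * x i - g) * d i)
     = \<pi> * (1 - \<pi> * (1 + (\<Sum>i\<le>5. (sqrt 5 * x i - g) * d i)))"
    by (simp add: power2_eq_square algebra_simps)
  moreover have "golden_ratio powi (- 1) = g" by (simp add: g_def power_int_minus divide_inverse)
  moreover have "((\<lambda>L. variance_S N L j) \<longlongrightarrow> real N * (\<pi> - \<pi>\<^sup>2 - \<pi>\<^sup>2 * (\<Sum>i\<le>5. (sqrt 5 * x i - g) * d i)))
      (inf sequentially (principal {L. odd L \<and> L \<ge> 7}))"
    unfolding \<pi>_def d_def x_def g_def by (rule expectation_variance_lim(2)[OF assms(2)])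
  moreover have "((\<lambda>L. expectation_S N L j) \<longlongrightarrow> real N * \<pi>) (inf sequentially (principal {L. odd L \<and> L \<ge> 7}))"
    unfolding \<pi>_def by (rule expectation_variance_lim(1)[OF assms(2)])
  ultimately show ?thesis
    unfolding times_divide_eq_right[symmetric] \<pi> by (simp add: mult.assoc)
qed

end
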